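(* Let $X$ be a non-empty dense-in-itself metric space. (1) The Hilbert system $\mathrm{S4.UC}$ is complete over $X$ for $\mathcal L_{\Box\forall}$-formulas, and sound if $X$ is connected. (2) The Hilbert system $\mathrm{S4}t\mathrm{.UC}$ is complete over $X$ for $\mathcal L_{\Box\forall}^{\langle t\rangle}$-formulas, and sound if $X$ is connected.
   Context: A metric space is regarded as a topological space with its metric topology; a space is dense in itself if no singleton subset is open, and connected if it is not the union of two disjoint non-empty open sets. $\mathrm{cl}$ denotes closure. LANGUAGES. $\mathsf{Var}$ is a fixed set of propositional variables (atoms). $\mathcal L_{\Box\forall}^{\langle t\rangle}$-formulas: atoms; $\top$; $\neg\varphi$; $\varphi\wedge\psi$; $\Box\varphi$; $\forall\varphi$; and $\langle t\rangle\Delta$ for each non-empty finite set $\Delta$ of formulas. $\mathcal L_{\Box\forall}$-formulas are those not involving $\langle t\rangle$. Abbreviations: $\vee,\to,\leftrightarrow$ as usual, $\Diamond\varphi=\neg\Box\neg\varphi$, $\exists\varphi=\neg\forall\neg\varphi$, $\Box^*\varphi=\varphi\wedge\Box\varphi$. SEMANTICS. An assignment into $X$ is a map $h:\mathsf{Var}\to\wp(X)$. Truth $(X,h),x\models\varphi$ at $x\in X$: atoms $p$ are true iff $x\in h(p)$; $\top$ and Booleans as usual; $\Box\varphi$ is true at $x$ iff some open neighbourhood $O$ of $x$ has $\varphi$ true at every $y\in O$; $\forall\varphi$ is true at $x$ iff $\varphi$ is true at every $y\in X$; $\langle t\rangle\Delta$ is true at $x$ iff there is $S\subseteq X$ with $x\in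 S\subseteq\bigcap_{\delta\in\Delta}\mathrm{cl}([\![\delta]\!]\cap S)$, where $[\![\delta]\!]=\{y\in X:(X,h),y\models\delta\}$. A formula is valid in $X$ if it is true at every point of $X$ under every assignment into $X$. SYSTEMS. $\mathrm{S4.UC}$ (for $\mathcal L_{\Box\forall}$): axioms are all instances of propositional tautologies; $\Box(\varphi\to\psi)\to(\Box\varphi\to\Box\psi)$; $\Box\varphi\to\varphi$; $\Box\varphi\to\Box\Box\varphi$; the S5 axioms for $\forall$ (namely $\forall(\varphi\to\psi)\to(\forall\varphi\to\forall\psi)$, $\forall\varphi\to\varphi$, $\forall\varphi\to\forall\forall\varphi$, $\varphi\to\forall\exists\varphi$); (U) $\forall\varphi\to\Box\varphi$; (C) $\forall(\Box^*\varphi\vee\Box^*\neg\varphi)\to(\forall\varphi\vee\forall\neg\varphi)$. Rules: modus ponens; from $\varphi$ infer $\Box\varphi$; from $\varphi$ infer $\forall\varphi$. $\mathrm{S4}t\mathrm{.UC}$ (for $\mathcal L_{\Box\forall}^{\langle t\rangle}$) has the same axiom schemes and rules (for formulas of this language) plus (Fix) $\langle t\rangle\Gamma\to\Diamond(\gamma\wedge\langle t\rangle\Gamma)$ for each $\gamma\in\Gamma$, and (Ind) $\Box^*(\varphi\to\bigwedge_{\gamma\in\Gamma}\Diamond(\gamma\wedge\varphi))\to(\varphi\to\langle t\rangle\Gamma)$. A Hilbert system is sound over $X$ if all its theorems are valid in $X$, and complete over $X$ if every formula of its language that is valid in $X$ is a theorem. *)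

theory Defs
  imports "HOL-Analysis.Analysis" "HOL-Library.FSet"
begin

section \<open>Languages\<close>

text \<open>
  The type variable \<open>'v\<close> is the set of atoms. The constructor \<open>Tangle\<close> also accepts the empty
  set; \<open>lang_tangle\<close> excludes it, and \<open>lang_basic\<close> consists of the formulas without \<open>Tangle\<close>.
\<close>

datatype 'v fm =
    Atom 'v
  | Top
  | Neg "'v fm"
  | And "'v fm" "'v fm"  (infixr "\<^bold>\<and>" 65)
  | Box "'v fm"
  | Univ "'v fm"
  | Tangle "'v fm fset"

abbreviation Or :: "'v fm \<Rightarrow> 'v fm \<Rightarrow> 'v fm"  (infixr "\<^bold>\<or>" 60) where
  "\<phi> \<^bold>\<or> \<psi> \<equiv> Neg (Neg \<phi> \<^bold>\<and> Neg \<psi>)"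

abbreviation Imp :: "'v fm \<Rightarrow> 'v fm \<Rightarrow> 'v fm"  (infixr "\<^bold>\<rightarrow>" 55) where
  "\<phi> \<^bold>\<rightarrow> \<psi> \<equiv> Neg (\<phi> \<^bold>\<and> Neg \<psi>)"

abbreviation Dia :: "'v fm \<Rightarrow> 'v fm" where
  "Dia \<phi> \<equiv> Neg (Box (Neg \<phi>))"

abbreviation Exis :: "'v fm \<Rightarrow> 'v fm" where
  "Exis \<phi> \<equiv> Neg (Univ (Neg \<phi>))"

abbreviation Box_star :: "'v fm \<Rightarrow> 'v fm" where
  "Box_star \<phi> \<equiv> \<phi> \<^bold>\<and> Box \<phi>"

definition Conj :: "'v fm list \<Rightarrow> 'v fm" where
  "Conj \<phi>s = foldr And \<phi>s Top"

inductive_set lang_tangle :: "'v fm set" where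
  "Atom p \<in> lang_tangle"
| "Top \<in> lang_tangle"
| "\<phi> \<in> lang_tangle \<Longrightarrow> Neg \<phi> \<in> lang_tangle"
| "\<phi> \<in> lang_tangle \<Longrightarrow> \<psi> \<in> lang_tangle \<Longrightarrow> \<phi> \<^bold>\<and> \<psi> \<in> lang_tangle"
| "\<phi> \<in> lang_tangle \<Longrightarrow> Box \<phi> \<in> lang_tangle"
| "\<phi> \<in> lang_tangle \<Longrightarrow> Univ \<phi> \<in> lang_tangle"
| "\<Delta> \<noteq> {||} \<Longrightarrow> (\<And>\<delta>. \<delta> |\<in>| \<Delta> \<Longrightarrow> \<delta> \<in> lang_tangle) \<Longrightarrow> Tangle \<Delta> \<in> lang_tangle"

inductive_set lang_basic :: "'v fm set" where
  "Atom p \<in> lang_basic"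
| "Top \<in> lang_basic"
| "\<phi> \<in> lang_basic \<Longrightarrow> Neg \<phi> \<in> lang_basic"
| "\<phi> \<in> lang_basic \<Longrightarrow> \<psi> \<in> lang_basic \<Longrightarrow> \<phi> \<^bold>\<and> \<psi> \<in> lang_basic"
| "\<phi> \<in> lang_basic \<Longrightarrow> Box \<phi> \<in> lang_basic"
| "\<phi> \<in> lang_basic \<Longrightarrow> Univ \<phi> \<in> lang_basic"


section \<open>Semantics\<close>

lemma size_fset_mem [termination_simp]:
  "\<delta> |\<in>| \<Delta> \<Longrightarrow> size \<delta> < Suc (\<Sum>x\<in>fset \<Delta>. Suc (size x))"
  using member_le_sum[of \<delta> "fset \<Delta>" "\<lambda>x. Suc (size x)"] by simp

fun holds :: "('v \<Rightarrow> 'a::topological_space set) \<Rightarrow> 'a \<Rightarrow> 'v fm \<Rightarrow> bool" where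
  "holds h x (Atom p) \<longleftrightarrow> x \<in> h p"
| "holds h x Top \<longleftrightarrow> True"
| "holds h x (Neg \<phi>) \<longleftrightarrow> \<not> holds h x \<phi>"
| "holds h x (\<phi> \<^bold>\<and> \<psi>) \<longleftrightarrow> holds h x \<phi> \<and> holds h x \<psi>"
| "holds h x (Box \<phi>) \<longleftrightarrow> (\<exists>U. open U \<and> x \<in> U \<and> (\<forall>y\<in>U. holds h y \<phi>))"
| "holds h x (Univ \<phi>) \<longleftrightarrow> (\<forall>y. holds h y \<phi>)"
| "holds h x (Tangle \<Delta>) \<longleftrightarrow>
     (\<exists>S. x \<in> S \<and> S \<subseteq> (\<Inter>\<delta>\<in>fset \<Delta>. closure ({y. holds h y \<delta>} \<inter> S)))"

definition valid_in :: "'a::topological_space itself \<Rightarrow> 'v fm \<Rightarrow> bool" where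
  "valid_in X \<phi> \<longleftrightarrow> (\<forall>(h :: 'v \<Rightarrow> 'a set) x. holds h x \<phi>)"


section \<open>Hilbert systems\<close>

text \<open>
  A formula is an instance of a propositional tautology iff it is true under every truth-value
  assignment to formulas whose main connective is not Boolean.
\<close>

fun bool_eval :: "('v fm \<Rightarrow> bool) \<Rightarrow> 'v fm \<Rightarrow> bool" where
  "bool_eval v Top \<longleftrightarrow> True"
| "bool_eval v (Neg \<phi>) \<longleftrightarrow> \<not> bool_eval v \<phi>"
| "bool_eval v (\<phi> \<^bold>\<and> \<psi>) \<longleftrightarrow> bool_eval v \<phi> \<and> bool_eval v \<psi>"
| "bool_eval v \<phi> \<longleftrightarrow> v \<phi>"

definition tautology :: "'v fm \<Rightarrow> bool" where
  "tautology \<phi> \<longleftrightarrow> (\<forall>v. bool_eval v \<phi>)"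

inductive S4UC_axiom :: "'v fm \<Rightarrow> bool" where
  Taut: "tautology \<phi> \<Longrightarrow> S4UC_axiom \<phi>"
| Box_K: "S4UC_axiom (Box (\<phi> \<^bold>\<rightarrow> \<psi>) \<^bold>\<rightarrow> (Box \<phi> \<^bold>\<rightarrow> Box \<psi>))"
| Box_T: "S4UC_axiom (Box \<phi> \<^bold>\<rightarrow> \<phi>)"
| Box_4: "S4UC_axiom (Box \<phi> \<^bold>\<rightarrow> Box (Box \<phi>))"
| Univ_K: "S4UC_axiom (Univ (\<phi> \<^bold>\<rightarrow> \<psi>) \<^bold>\<rightarrow> (Univ \<phi> \<^bold>\<rightarrow> Univ \<psi>))"
| Univ_T: "S4UC_axiom (Univ \<phi> \<^bold>\<rightarrow> \<phi>)"
| Univ_4: "S4UC_axiom (Univ \<phi> \<^bold>\<rightarrow> Univ (Univ \<phi>))"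
| Univ_B: "S4UC_axiom (\<phi> \<^bold>\<rightarrow> Univ (Exis \<phi>))"
| U: "S4UC_axiom (Univ \<phi> \<^bold>\<rightarrow> Box \<phi>)"
| C: "S4UC_axiom (Univ (Box_star \<phi> \<^bold>\<or> Box_star (Neg \<phi>)) \<^bold>\<rightarrow> (Univ \<phi> \<^bold>\<or> Univ (Neg \<phi>)))"

text \<open>
  In \<open>Ind\<close>, the list \<open>\<gamma>s\<close> is an arbitrary enumeration of the finite set \<open>\<Gamma>\<close>.
\<close>

inductive tangle_axiom :: "'v fm \<Rightarrow> bool" where
  Fix: "\<gamma> |\<in>| \<Gamma> \<Longrightarrow> tangle_axiom (Tangle \<Gamma> \<^bold>\<rightarrow> Dia (\<gamma> \<^bold>\<and> Tangle \<Gamma>))"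
| Ind: "fset_of_list \<gamma>s = \<Gamma> \<Longrightarrow>
    tangle_axiom (Box_star (\<phi> \<^bold>\<rightarrow> Conj (map (\<lambda>\<gamma>. Dia (\<gamma> \<^bold>\<and> \<phi>)) \<gamma>s)) \<^bold>\<rightarrow> (\<phi> \<^bold>\<rightarrow> Tangle \<Gamma>))"

text \<open>
  Theorems of the system whose axioms are the members of the language \<open>L\<close> satisfying \<open>Ax\<close>. As
  \<open>lang_basic\<close> and \<open>lang_tangle\<close> are closed under subformulas, an axiom lies in the language iff
  it is an instance of its scheme by formulas of the language.
\<close>

inductive hilbert_thm :: "'v fm set \<Rightarrow> ('v fm \<Rightarrow> bool) \<Rightarrow> 'v fm \<Rightarrow> bool"
  for L :: "'v fm set" and Ax :: "'v fm \<Rightarrow> bool" where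
  Axiom: "\<phi> \<in> L \<Longrightarrow> Ax \<phi> \<Longrightarrow> hilbert_thm L Ax \<phi>"
| MP: "hilbert_thm L Ax (\<phi> \<^bold>\<rightarrow> \<psi>) \<Longrightarrow> hilbert_thm L Ax \<phi> \<Longrightarrow> hilbert_thm L Ax \<psi>"
| Box_Gen: "hilbert_thm L Ax \<phi> \<Longrightarrow> hilbert_thm L Ax (Box \<phi>)"
| Univ_Gen: "hilbert_thm L Ax \<phi> \<Longrightarrow> hilbert_thm L Ax (Univ \<phi>)"

definition S4UC :: "'v fm \<Rightarrow> bool" where
  "S4UC = hilbert_thm lang_basic S4UC_axiom"

definition S4tUC :: "'v fm \<Rightarrow> bool" where
  "S4tUC = hilbert_thm lang_tangle (\<lambda>\<phi>. S4UC_axiom \<phi> \<or> tangle_axiom \<phi>)"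

definition sound_over :: "'a::topological_space itself \<Rightarrow> ('v fm \<Rightarrow> bool) \<Rightarrow> bool" where
  "sound_over X thm_of \<longleftrightarrow> (\<forall>\<phi>. thm_of \<phi> \<longrightarrow> valid_in X \<phi>)"

definition complete_over ::
  "'a::topological_space itself \<Rightarrow> 'v fm set \<Rightarrow> ('v fm \<Rightarrow> bool) \<Rightarrow> bool" where
  "complete_over X L thm_of \<longleftrightarrow> (\<forall>\<phi>\<in>L. valid_in X \<phi> \<longrightarrow> thm_of \<phi>)"

end

theory Submission
  imports Defs
begin

text \<open>
  Completeness splits into a Kripke and a topological part. A non-theorem is refuted in a finite
  preorder obtained by refining a filtration of the canonical model; axiom (C) makes this preorder
  connected, because unions of its components are definable. Open continuous maps preserve truth,
  including truth of the tangle, so it suffices to map \<open>X\<close> onto the preorder by such a map. First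
  every open set is mapped onto each cone \<open>{v. R w v}\<close> so that each point of the
  frontier is a limit of every fibre. Then the range is enlarged step by step: if \<open>f x\<^sub>0\<close> lies above
  a point \<open>u\<close> outside the range, \<open>f\<close> is replaced on a small ball near \<open>x\<^sub>0\<close> by a map onto the
  cone of \<open>u\<close>, and the frontier of the ball is sent to \<open>u\<close>.
\<close>

subsection \<open>Soundness\<close>

text \<open>Merging points by type alone is too coarse for the tangle: a finite ascending chain on
  which \<open>p\<close> and \<open>Neg p\<close> alternate collapses to a cluster in which the
  tangle of \<open>p\<close> and \<open>Neg p\<close> becomes true. This is why nodes carry more
  data than a type. The extra data must be expressible by formulas, since (Ind) and (C) are schemes
  and only speak about properties that some formula defines; the property \<open>seen x = T\<close>
  meets this demand because there are finitely many types.

  On the topological side, openness already makes the range of a map upward closed, so only downward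
  steps have to be forced. Each such step takes place in an arbitrarily small ball and saves all
  values taken so far. Connectedness of the frame then gives surjectivity, while connectedness of
  the space enters only through the soundness of (C).

  Both systems are handled at once: the logic is developed over a language \<open>L\<close> closed
  under subformulas, and no tangle axiom is a formula of \<open>lang_basic\<close>.\<close>

lemma bool_eval_holds: "bool_eval (holds h x) \<phi> = holds h x \<phi>"
  by (induction \<phi>) auto

lemma holds_Conj [simp]: "holds h x (Conj \<phi>s) \<longleftrightarrow> (\<forall>\<phi>\<in>set \<phi>s. holds h x \<phi>)"
  by (induction \<phi>s) (auto simp: Conj_def)

lemma holds_Imp: "holds h x (\<phi> \<^bold>\<rightarrow> \<psi>) \<longleftrightarrow> (holds h x \<phi> \<longrightarrow> holds h x \<psi>)"
  by simp

lemma holds_Or: "holds h x (\<phi> \<^bold>\<or> \<psi>) \<longleftrightarrow> holds h x \<phi> \<or> holds h x \<psi>"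
  by simp

lemma holds_Box: "holds h x (Box \<phi>) \<longleftrightarrow> x \<in> interior {y. holds h y \<phi>}"
  by (auto simp: interior_def)

lemma holds_Dia: "holds h x (Dia \<phi>) \<longleftrightarrow> x \<in> closure {y. holds h y \<phi>}"
  by (simp only: holds.simps(3) holds_Box closure_interior Compl_iff Collect_neg_eq)

lemma holds_Tangle:
  "holds h x (Tangle \<Delta>) \<longleftrightarrow>
     (\<exists>S. x \<in> S \<and> (\<forall>y\<in>S. \<forall>\<delta>\<in>fset \<Delta>. y \<in> closure ({y. holds h y \<delta>} \<inter> S)))"
  by auto

lemma valid_S4UC_axiom:
  fixes h :: "'v \<Rightarrow> 'a::topological_space set"
  assumes "S4UC_axiom \<phi>" "connected (UNIV :: 'a set)"
  shows "holds h x \<phi>"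
  using assms(1)
proof cases
  case Taut
  then show ?thesis by (metis bool_eval_holds tautology_def)
next
  case (Box_K \<phi> \<psi>)
  have "{y. holds h y (\<phi> \<^bold>\<rightarrow> \<psi>)} \<inter> {y. holds h y \<phi>} \<subseteq> {y. holds h y \<psi>}" by auto
  from interior_mono[OF this] show ?thesis
    unfolding Box_K holds_Imp[of _ _ "Box _"] holds_Box by auto
next
  case (C \<psi>)
  \<comment> \<open>The premise of (C) puts every point in the interior of the truth set of
    \<open>\<psi>\<close> or of its complement, so the truth set is clopen.\<close>
  have "(\<forall>y. holds h y \<psi>) \<or> (\<forall>y. \<not> holds h y \<psi>)"
    if *: "\<And>y. holds h y (Box_star \<psi> \<^bold>\<or> Box_star (Neg \<psi>))"
  proof -
    let ?A = "{y. holds h y \<psi>}"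
    have **: "y \<in> ?A \<inter> interior ?A \<or> y \<in> (- ?A) \<inter> interior (- ?A)" for y
      using *[of y] unfolding holds_Or holds.simps(3,4) holds_Box Collect_neg_eq by simp
    have "?A \<subseteq> interior ?A" "- ?A \<subseteq> interior (- ?A)" using ** by blast+
    then have "open ?A" "open (- ?A)"
      by (metis interior_subset interior_eq subset_antisym)+
    then have "?A = {} \<or> ?A = UNIV"
      using assms(2) unfolding connected_clopen closed_def[symmetric] open_openin[symmetric] by (metis closed_closedin closed_def open_openin subtopology_UNIV)
    then show ?thesis by auto
  qed
    then show ?thesis
    unfolding C holds_Imp[of _ _ "Univ (_ \<^bold>\<or> _)"] holds_Or[of _ _ "Univ _"] holds.simps(3)[of _ _ \<psi>] holds.simps(6)
    by blast
next
  case (Box_T \<psi>)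
  show ?thesis unfolding Box_T holds_Imp holds_Box using interior_subset by blast
next
  case (Box_4 \<psi>)
  show ?thesis unfolding Box_4 holds_Imp holds_Box by simp
next
  case (U \<psi>)
  show ?thesis unfolding U holds_Imp holds_Box by simp
qed auto

lemma valid_tangle_axiom:
  assumes "tangle_axiom \<phi>"
  shows "holds h x \<phi>"
  using assms
proof cases
  case (Fix \<gamma> \<Gamma>)
  have "x \<in> closure {y. holds h y (\<gamma> \<^bold>\<and> Tangle \<Gamma>)}"
    if "x \<in> S" "\<forall>y\<in>S. \<forall>\<delta>\<in>fset \<Gamma>. y \<in> closure ({y. holds h y \<delta>} \<inter> S)" for S
  proof (rule closure_mono[THEN subsetD])
    show "x \<in> closure ({y. holds h y \<gamma>} \<inter> S)" using that Fix by blast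
    \<comment> \<open>The same \<open>S\<close> witnesses the tangle at each of its points.\<close>
    show "{y. holds h y \<gamma>} \<inter> S \<subseteq> {y. holds h y (\<gamma> \<^bold>\<and> Tangle \<Gamma>)}"
      using that(2) unfolding holds.simps(4) holds_Tangle by blast
  qed
  then show ?thesis
    unfolding Fix holds_Imp holds_Dia using holds_Tangle by metis
next
  case (Ind \<gamma>s \<Gamma> \<psi>)
  let ?\<theta> = "\<psi> \<^bold>\<rightarrow> Conj (map (\<lambda>\<gamma>. Dia (\<gamma> \<^bold>\<and> \<psi>)) \<gamma>s)"
  define U where "U = interior {y. holds h y ?\<theta>}"
  have *: "y \<in> closure {z. holds h z (\<gamma> \<^bold>\<and> \<psi>)}"
    if "y \<in> U" "holds h y \<psi>" "\<gamma> \<in> set \<gamma>s" for y \<gamma>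
  proof -
    have "holds h y ?\<theta>" using that(1) interior_subset unfolding U_def by blast
    then have "holds h y (Dia (\<gamma> \<^bold>\<and> \<psi>))"
      using that(2,3) unfolding holds_Imp holds_Conj by auto
    then show ?thesis unfolding holds_Dia .
  qed
  have "holds h x (Tangle \<Gamma>)" if U: "x \<in> U" "holds h x \<psi>"
    unfolding holds_Tangle
  \<comment> \<open>The witness is the truth set of \<open>\<psi>\<close> cut down to the open set
    \<open>U\<close> where the premise of (Ind) holds; closure at points of an open set can be
    computed inside that set.\<close>
  proof (intro exI[of _ "{y\<in>U. holds h y \<psi>}"] conjI ballI)
    fix y \<delta> assume y: "y \<in> {y\<in>U. holds h y \<psi>}" and "\<delta> \<in> fset \<Gamma>"
    then have "\<delta> \<in> set \<gamma>s" using Ind by (auto simp: fset_of_list.rep_eq)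
    then have "y \<in> closure {z. holds h z (\<delta> \<^bold>\<and> \<psi>)}" using *[of y \<delta>] y by auto
    then have "y \<in> closure (U \<inter> {z. holds h z (\<delta> \<^bold>\<and> \<psi>)})"
      using open_Int_closure_subset[of U] y unfolding U_def by blast
    moreover have "U \<inter> {z. holds h z (\<delta> \<^bold>\<and> \<psi>)} = {y. holds h y \<delta>} \<inter> {y \<in> U. holds h y \<psi>}" by auto
    ultimately show "y \<in> closure ({y. holds h y \<delta>} \<inter> {y \<in> U. holds h y \<psi>})" by simp
  qed (use U in auto)
  then show ?thesis
    unfolding Ind holds_Imp[of _ _ "Box_star _"] holds_Imp[of _ _ _ "Tangle _"] holds.simps(4) holds_Box U_def by blast
qed

lemma hilbert_thm_valid:
  assumes "hilbert_thm L Ax \<phi>" "\<And>\<phi> (h :: 'v \<Rightarrow> 'a::topological_space set) x. Ax \<phi> \<Longrightarrow> holds h x \<phi>"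
  shows "holds (h :: 'v \<Rightarrow> 'a set) x \<phi>"
  using assms(1)
proof (induction arbitrary: x rule: hilbert_thm.induct)
  case (Box_Gen \<phi>)
  then show ?case unfolding holds_Box by simp
qed (auto simp: assms(2))

subsection \<open>Maximal consistent sets\<close>

text \<open>For \<open>Tangle\<close> only closure under subformulas is demanded, so the language
  without tangles is an instance too.\<close>

locale tangle_logic =
  fixes L :: "'v fm set"
  assumes L_Top [simp]: "Top \<in> L"
    and L_Neg [simp]: "Neg \<phi> \<in> L \<longleftrightarrow> \<phi> \<in> L"
    and L_And [simp]: "\<phi> \<^bold>\<and> \<psi> \<in> L \<longleftrightarrow> \<phi> \<in> L \<and> \<psi> \<in> L"
    and L_Box [simp]: "Box \<phi> \<in> L \<longleftrightarrow> \<phi> \<in> L"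
    and L_Univ [simp]: "Univ \<phi> \<in> L \<longleftrightarrow> \<phi> \<in> L"
    and L_Tangle: "Tangle \<Gamma> \<in> L \<Longrightarrow> \<gamma> |\<in>| \<Gamma> \<Longrightarrow> \<gamma> \<in> L"
begin

abbreviation prov :: "'v fm \<Rightarrow> bool" where
  "prov \<equiv> hilbert_thm L (\<lambda>\<phi>. S4UC_axiom \<phi> \<or> tangle_axiom \<phi>)"

lemma prov_L: "prov \<phi> \<Longrightarrow> \<phi> \<in> L"
  by (induction rule: hilbert_thm.induct) auto

lemma L_Conj [simp]: "Conj \<phi>s \<in> L \<longleftrightarrow> set \<phi>s \<subseteq> L"
  by (induction \<phi>s) (auto simp: Conj_def)

lemma bool_eval_Conj [simp]: "bool_eval v (Conj \<phi>s) \<longleftrightarrow> (\<forall>\<phi>\<in>set \<phi>s. bool_eval v \<phi>)"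
  by (induction \<phi>s) (auto simp: Conj_def)

text \<open>Turns propositional reasoning into truth tables: all tautologies are axioms, and the
  premises are discharged one by one by modus ponens.\<close>

lemma prov_conseq:
  assumes "\<And>\<phi>. \<phi> \<in> set \<phi>s \<Longrightarrow> prov \<phi>" "\<psi> \<in> L"
    "\<And>v. \<forall>\<phi>\<in>set \<phi>s. bool_eval v \<phi> \<Longrightarrow> bool_eval v \<psi>"
  shows "prov \<psi>"
  using assms
proof (induction \<phi>s arbitrary: \<psi>)
  case Nil
  then show ?case by (auto intro!: hilbert_thm.Axiom S4UC_axiom.Taut simp: tautology_def)
next
  case (Cons \<phi> \<phi>s)
  have "prov \<phi>" using Cons.prems(1) by simp
  moreover have "prov (\<phi> \<^bold>\<rightarrow> \<psi>)"
  proof (rule Cons.IH)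
    show "bool_eval v (\<phi> \<^bold>\<rightarrow> \<psi>)" if "\<forall>\<phi>\<in>set \<phi>s. bool_eval v \<phi>" for v
      using that Cons.prems(3)[of v] by auto
  qed (use Cons.prems prov_L in auto)
  ultimately show ?case by (blast intro: hilbert_thm.MP)
qed

definition consistent :: "'v fm set \<Rightarrow> bool" where
  "consistent A \<longleftrightarrow> A \<subseteq> L \<and> (\<forall>\<phi>s. set \<phi>s \<subseteq> A \<longrightarrow> \<not> prov (Neg (Conj \<phi>s)))"

definition mcs :: "'v fm set \<Rightarrow> bool" where
  "mcs A \<longleftrightarrow> consistent A \<and> (\<forall>\<phi>\<in>L. consistent (insert \<phi> A) \<longrightarrow> \<phi> \<in> A)"

text \<open>Zorn's lemma is used because the set of atoms is arbitrary, so the formulas need not be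
  enumerable.\<close>

lemma lindenbaum:
  assumes "consistent A"
  obtains B where "A \<subseteq> B" "mcs B"
proof -
  let ?F = "{B. A \<subseteq> B \<and> consistent B}"
  have "\<exists>M\<in>?F. \<forall>X\<in>?F. M \<subseteq> X \<longrightarrow> X = M"
  proof (rule subset_Zorn_nonempty)
    fix C assume C: "C \<noteq> {}" "subset.chain ?F C"
    then have sub: "C \<subseteq> ?F" by (auto simp: subset.chain_def)
    have "consistent (\<Union>C)"
      unfolding consistent_def
    proof (intro conjI allI impI)
      show "\<Union>C \<subseteq> L" using sub by (auto simp: consistent_def)
      fix \<phi>s assume "set \<phi>s \<subseteq> \<Union>C"
      then obtain B where "B \<in> C" "set \<phi>s \<subseteq> B"
        using finite_subset_Union_chain[OF _ _ C] by (metis List.finite_set)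
      then show "\<not> prov (Neg (Conj \<phi>s))" using sub by (auto simp: consistent_def)
    qed
    then show "\<Union>C \<in> ?F" using C sub by auto
  qed (use assms in auto)
  then obtain M where M: "A \<subseteq> M" "consistent M" and max: "\<And>X. A \<subseteq> X \<Longrightarrow> consistent X \<Longrightarrow> M \<subseteq> X \<Longrightarrow> X = M"
    by auto
  have "mcs M"
    unfolding mcs_def
  proof (intro conjI ballI impI M)
    fix \<phi> assume "consistent (insert \<phi> M)"
    then show "\<phi> \<in> M" using max[of "insert \<phi> M"] M by blast
  qed
  then show thesis using that M by blast
qed

lemma mcs_subset: "mcs x \<Longrightarrow> x \<subseteq> L"
  by (simp add: mcs_def consistent_def)

lemma mcs_not_mem:
  assumes "mcs x" "\<phi> \<in> L" "\<phi> \<notin> x"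
  obtains \<phi>s where "set \<phi>s \<subseteq> x" "prov (Conj \<phi>s \<^bold>\<rightarrow> Neg \<phi>)"
proof -
  obtain \<psi>s where \<psi>s: "set \<psi>s \<subseteq> insert \<phi> x" "prov (Neg (Conj \<psi>s))"
    using assms mcs_subset[OF assms(1)] unfolding mcs_def consistent_def by blast
  let ?\<phi>s = "filter (\<lambda>\<psi>. \<psi> \<in> x) \<psi>s"
  have "prov (Conj ?\<phi>s \<^bold>\<rightarrow> Neg \<phi>)"
    by (rule prov_conseq[of "[Neg (Conj \<psi>s)]"]) (use \<psi>s assms(2) prov_L[OF \<psi>s(2)] in auto)
  then show thesis using that[of ?\<phi>s] by auto
qed

lemma mcs_conseq:
  assumes "mcs x" "set \<phi>s \<subseteq> x" "prov (Conj \<phi>s \<^bold>\<rightarrow> \<psi>)"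
  shows "\<psi> \<in> x"
proof (rule ccontr)
  assume "\<psi> \<notin> x"
  have "\<psi> \<in> L" using prov_L[OF assms(3)] by simp
  then obtain \<psi>s where \<psi>s: "set \<psi>s \<subseteq> x" "prov (Conj \<psi>s \<^bold>\<rightarrow> Neg \<psi>)"
    using mcs_not_mem assms(1) \<open>\<psi> \<notin> x\<close> by blast
  have "prov (Neg (Conj (\<phi>s @ \<psi>s)))"
    by (rule prov_conseq[of "[Conj \<phi>s \<^bold>\<rightarrow> \<psi>, Conj \<psi>s \<^bold>\<rightarrow> Neg \<psi>]"])
      (use \<psi>s assms mcs_subset[OF assms(1)] in auto)
  then show False
    using assms(1,2) \<psi>s(1) unfolding mcs_def consistent_def by (metis set_append le_sup_iff)
qed

lemma mcs_prov:
  assumes "mcs x" "prov \<phi>"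
  shows "\<phi> \<in> x"
proof (rule mcs_conseq[OF assms(1)])
  show "prov (Conj [] \<^bold>\<rightarrow> \<phi>)"
    by (rule prov_conseq[of "[\<phi>]"]) (use assms(2) prov_L[OF assms(2)] in auto)
qed simp

lemma mcs_Neg:
  assumes "mcs x" "\<phi> \<in> L"
  shows "Neg \<phi> \<in> x \<longleftrightarrow> \<phi> \<notin> x"
proof
  assume "\<phi> \<notin> x"
  then show "Neg \<phi> \<in> x" using mcs_not_mem mcs_conseq assms by metis
next
  assume *: "Neg \<phi> \<in> x"
  have "prov (Neg (Conj [\<phi>, Neg \<phi>]))"
    by (rule prov_conseq[of "[]"]) (use assms in auto)
  then show "\<phi> \<notin> x"
    using * assms unfolding mcs_def consistent_def by (metis empty_set empty_subsetI insert_subset list.simps(15))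
qed

lemma mcs_And:
  assumes "mcs x"
  shows "\<phi> \<^bold>\<and> \<psi> \<in> x \<longleftrightarrow> \<phi> \<in> x \<and> \<psi> \<in> x"
proof
  assume *: "\<phi> \<^bold>\<and> \<psi> \<in> x"
  then have L: "\<phi> \<in> L" "\<psi> \<in> L" using mcs_subset[OF assms] by auto
  have "prov (Conj [\<phi> \<^bold>\<and> \<psi>] \<^bold>\<rightarrow> \<phi>)" "prov (Conj [\<phi> \<^bold>\<and> \<psi>] \<^bold>\<rightarrow> \<psi>)"
    by (rule prov_conseq[of "[]"]; use L in simp)+
  then show "\<phi> \<in> x \<and> \<psi> \<in> x" using mcs_conseq[OF assms, of "[\<phi> \<^bold>\<and> \<psi>]"] * by auto
next
  assume *: "\<phi> \<in> x \<and> \<psi> \<in> x"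
  then have L: "\<phi> \<in> L" "\<psi> \<in> L" using mcs_subset[OF assms] by auto
  have "prov (Conj [\<phi>, \<psi>] \<^bold>\<rightarrow> \<phi> \<^bold>\<and> \<psi>)"
    by (rule prov_conseq[of "[]"]) (use L in simp_all)
  then show "\<phi> \<^bold>\<and> \<psi> \<in> x" using mcs_conseq[OF assms, of "[\<phi>, \<psi>]"] * by auto
qed

lemma mcs_Imp: "mcs x \<Longrightarrow> \<phi> \<in> L \<Longrightarrow> \<psi> \<in> L \<Longrightarrow> \<phi> \<^bold>\<rightarrow> \<psi> \<in> x \<longleftrightarrow> (\<phi> \<in> x \<longrightarrow> \<psi> \<in> x)"
  by (simp add: mcs_Neg mcs_And)

lemma mcs_Conj: "mcs x \<Longrightarrow> Conj \<phi>s \<in> x \<longleftrightarrow> set \<phi>s \<subseteq> x"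
proof (induction \<phi>s)
  case Nil
  have "prov Top" by (rule prov_conseq[of "[]"]) auto
  then show ?case using Nil mcs_prov by (auto simp: Conj_def)
next
  case (Cons \<phi> \<phi>s)
  then show ?case using mcs_And[OF Cons.prems, of \<phi> "Conj \<phi>s"] by (simp add: Conj_def)
qed

lemma mcs_axiom: "mcs x \<Longrightarrow> S4UC_axiom \<phi> \<or> tangle_axiom \<phi> \<Longrightarrow> \<phi> \<in> L \<Longrightarrow> \<phi> \<in> x"
  by (blast intro: mcs_prov hilbert_thm.Axiom)

text \<open>The existence lemma uses only K and necessitation; with the modality \<open>M\<close> as
  a parameter it serves both \<open>Box\<close> and \<open>Univ\<close>.\<close>

lemma mcs_modal_witness:
  assumes K: "\<And>\<phi> \<psi>. S4UC_axiom (M (\<phi> \<^bold>\<rightarrow> \<psi>) \<^bold>\<rightarrow> (M \<phi> \<^bold>\<rightarrow> M \<psi>))"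
    and gen: "\<And>\<phi>. prov \<phi> \<Longrightarrow> prov (M \<phi>)"
    and M_L: "\<And>\<phi>. M \<phi> \<in> L \<longleftrightarrow> \<phi> \<in> L"
    and x: "mcs x" "\<phi> \<in> L" "M \<phi> \<notin> x"
  obtains y where "mcs y" "\<And>\<psi>. M \<psi> \<in> x \<Longrightarrow> \<psi> \<in> y" "\<phi> \<notin> y"
proof -
  \<comment> \<open>The formulas that \<open>x\<close> necessitates are closed under deduction: move
    the premises into the conclusion one at a time and apply K to each.\<close>
  have *: "M \<psi> \<in> x" if "prov (Conj \<psi>s \<^bold>\<rightarrow> \<psi>)" "\<forall>\<psi>\<in>set \<psi>s. M \<psi> \<in> x" for \<psi>s \<psi>
    using that
  proof (induction \<psi>s arbitrary: \<psi>)
    case Nil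
    have "prov \<psi>"
      by (rule prov_conseq[of "[Conj [] \<^bold>\<rightarrow> \<psi>]"]) (use Nil prov_L[OF Nil(1)] in auto)
    then show ?case using gen mcs_prov x(1) by blast
  next
    case (Cons \<theta> \<psi>s)
    have L: "\<psi> \<in> L" "\<theta> \<in> L" using prov_L[OF Cons.prems(1)] by auto
    have "M (\<theta> \<^bold>\<rightarrow> \<psi>) \<in> x"
    proof (rule Cons.IH)
      show "prov (Conj \<psi>s \<^bold>\<rightarrow> (\<theta> \<^bold>\<rightarrow> \<psi>))"
        by (rule prov_conseq[of "[Conj (\<theta> # \<psi>s) \<^bold>\<rightarrow> \<psi>]"])
          (use Cons.prems prov_L[OF Cons.prems(1)] in auto)
    qed (use Cons.prems in auto)
    moreover have "M (\<theta> \<^bold>\<rightarrow> \<psi>) \<^bold>\<rightarrow> (M \<theta> \<^bold>\<rightarrow> M \<psi>) \<in> x"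
      by (rule mcs_axiom[OF x(1)]) (use K L M_L in auto)
    ultimately show ?case
      using Cons.prems(2) L M_L by (simp add: mcs_Imp[OF x(1)])
  qed
  have sub: "{\<psi>. M \<psi> \<in> x} \<subseteq> L" using mcs_subset[OF x(1)] M_L by blast
  have "consistent (insert (Neg \<phi>) {\<psi>. M \<psi> \<in> x})"
    unfolding consistent_def
  proof (intro conjI allI impI notI)
    show "insert (Neg \<phi>) {\<psi>. M \<psi> \<in> x} \<subseteq> L" using sub x by simp
    fix \<psi>s assume \<psi>s: "set \<psi>s \<subseteq> insert (Neg \<phi>) {\<psi>. M \<psi> \<in> x}" "prov (Neg (Conj \<psi>s))"
    let ?\<psi>s = "filter (\<lambda>\<psi>. M \<psi> \<in> x) \<psi>s"
    have "prov (Conj ?\<psi>s \<^bold>\<rightarrow> \<phi>)"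
      by (rule prov_conseq[of "[Neg (Conj \<psi>s)]"])
        (use \<psi>s prov_L[OF \<psi>s(2)] x in \<open>auto simp: subset_eq\<close>)
    from *[OF this] x(3) show False by simp
  qed
  then obtain y where y: "insert (Neg \<phi>) {\<psi>. M \<psi> \<in> x} \<subseteq> y" "mcs y" by (rule lindenbaum)
  then show thesis using that[of y] x mcs_Neg by auto
qed

subsection \<open>The canonical model\<close>

definition le :: "'v fm set \<Rightarrow> 'v fm set \<Rightarrow> bool" where
  "le x y \<longleftrightarrow> mcs x \<and> mcs y \<and> (\<forall>\<psi>. Box \<psi> \<in> x \<longrightarrow> \<psi> \<in> y)"

definition sim :: "'v fm set \<Rightarrow> 'v fm set \<Rightarrow> bool" where
  "sim x y \<longleftrightarrow> mcs x \<and> mcs y \<and> (\<forall>\<psi>. Univ \<psi> \<in> x \<longrightarrow> \<psi> \<in> y)"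

lemma le_mcs: "le x y \<Longrightarrow> mcs x" "le x y \<Longrightarrow> mcs y"
  by (auto simp: le_def)

lemma sim_mcs: "sim x y \<Longrightarrow> mcs x" "sim x y \<Longrightarrow> mcs y"
  by (auto simp: sim_def)

lemma mcs_axiom_Imp:
  "mcs x \<Longrightarrow> S4UC_axiom (\<phi> \<^bold>\<rightarrow> \<psi>) \<or> tangle_axiom (\<phi> \<^bold>\<rightarrow> \<psi>) \<Longrightarrow> \<phi> \<in> x \<Longrightarrow> \<psi> \<in> L \<Longrightarrow> \<psi> \<in> x"
  using mcs_axiom[of x "\<phi> \<^bold>\<rightarrow> \<psi>"] mcs_Imp[of x \<phi> \<psi>] mcs_subset[of x] by auto

lemma le_refl: "mcs x \<Longrightarrow> le x x"
  unfolding le_def using mcs_axiom_Imp[OF _ disjI1[OF Box_T]] mcs_subset by fastforce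

lemma le_trans: "le x y \<Longrightarrow> le y z \<Longrightarrow> le x z"
  unfolding le_def using mcs_axiom_Imp[OF _ disjI1[OF Box_4]] mcs_subset by fastforce

lemma mcs_Box:
  assumes "mcs x" "\<phi> \<in> L"
  shows "Box \<phi> \<in> x \<longleftrightarrow> (\<forall>y. le x y \<longrightarrow> \<phi> \<in> y)"
proof (rule iffI)
  assume *: "\<forall>y. le x y \<longrightarrow> \<phi> \<in> y"
  show "Box \<phi> \<in> x"
  proof (rule ccontr)
    assume "Box \<phi> \<notin> x"
    then obtain y where "mcs y" "\<And>\<psi>. Box \<psi> \<in> x \<Longrightarrow> \<psi> \<in> y" "\<phi> \<notin> y"
      using mcs_modal_witness[of Box x \<phi>] assms by (auto intro: Box_K hilbert_thm.Box_Gen)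
    then show False using * assms by (auto simp: le_def)
  qed
qed (auto simp: le_def)

lemma mcs_Univ:
  assumes "mcs x" "\<phi> \<in> L"
  shows "Univ \<phi> \<in> x \<longleftrightarrow> (\<forall>y. sim x y \<longrightarrow> \<phi> \<in> y)"
proof (rule iffI)
  assume *: "\<forall>y. sim x y \<longrightarrow> \<phi> \<in> y"
  show "Univ \<phi> \<in> x"
  proof (rule ccontr)
    assume "Univ \<phi> \<notin> x"
    then obtain y where "mcs y" "\<And>\<psi>. Univ \<psi> \<in> x \<Longrightarrow> \<psi> \<in> y" "\<phi> \<notin> y"
      using mcs_modal_witness[of Univ x \<phi>] assms by (auto intro: Univ_K hilbert_thm.Univ_Gen)
    then show False using * assms by (auto simp: sim_def)
  qed
qed (auto simp: sim_def)

lemma mcs_Dia: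
  assumes "mcs x" "\<phi> \<in> L"
  shows "Dia \<phi> \<in> x \<longleftrightarrow> (\<exists>y. le x y \<and> \<phi> \<in> y)"
  using assms by (auto simp: mcs_Neg mcs_Box) (auto simp: mcs_Neg le_mcs)

lemma sim_refl: "mcs x \<Longrightarrow> sim x x"
  unfolding sim_def using mcs_axiom_Imp[OF _ disjI1[OF Univ_T]] mcs_subset by fastforce

lemma sim_trans: "sim x y \<Longrightarrow> sim y z \<Longrightarrow> sim x z"
  unfolding sim_def using mcs_axiom_Imp[OF _ disjI1[OF Univ_4]] mcs_subset by fastforce

lemma sim_sym:
  assumes "sim x y"
  shows "sim y x"
  unfolding sim_def
proof (intro conjI allI impI)
  fix \<psi> assume \<psi>: "Univ \<psi> \<in> y"
  have L: "\<psi> \<in> L" using \<psi> mcs_subset[OF sim_mcs(2)[OF assms]] by auto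
  show "\<psi> \<in> x"
  proof (rule ccontr)
    assume "\<psi> \<notin> x"
    then have "Univ (Exis (Neg \<psi>)) \<in> x"
      using mcs_axiom_Imp[OF _ disjI1[OF Univ_B]] sim_mcs[OF assms] L mcs_Neg by simp
    then have "Exis (Neg \<psi>) \<in> y" using assms by (simp add: sim_def)
    then have "Univ (Neg (Neg \<psi>)) \<notin> y" using sim_mcs[OF assms] L mcs_Neg by simp
    then obtain z where z: "sim y z" "\<psi> \<notin> z"
      using mcs_Univ[of y "Neg (Neg \<psi>)"] sim_mcs assms L mcs_Neg by auto
    then show False using \<psi> by (auto simp: sim_def)
  qed
qed (use sim_mcs assms in auto)

lemma le_sim: "le x y \<Longrightarrow> sim x y"
  unfolding le_def sim_def using mcs_axiom_Imp[OF _ disjI1[OF S4UC_axiom.U]] mcs_subset by fastforce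

text \<open>(Ind) and (C) can be applied only to formulas; this isolates the properties of points to
  which they apply, so that later arguments can be written with predicates.\<close>

definition definable :: "('v fm set \<Rightarrow> bool) \<Rightarrow> bool" where
  "definable Q \<longleftrightarrow> (\<exists>\<phi>\<in>L. \<forall>x. mcs x \<longrightarrow> (\<phi> \<in> x \<longleftrightarrow> Q x))"

lemma definable_mem: "\<phi> \<in> L \<Longrightarrow> definable (\<lambda>x. \<phi> \<in> x)"
  by (auto simp: definable_def)

lemma definable_Not: "definable Q \<Longrightarrow> definable (\<lambda>x. \<not> Q x)"
  unfolding definable_def by (metis mcs_Neg L_Neg)

lemma definable_conj: "definable Q \<Longrightarrow> definable Q' \<Longrightarrow> definable (\<lambda>x. Q x \<and> Q' x)"
  unfolding definable_def by (metis mcs_And L_And)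

lemma definable_const: "definable (\<lambda>x. c)"
proof -
  have "definable (\<lambda>x. True)"
    unfolding definable_def by (intro bexI[of _ "Conj []"]) (auto simp: mcs_Conj)
  then show ?thesis using definable_Not by (cases c) fastforce+
qed

lemma definable_ball: "finite A \<Longrightarrow> (\<And>a. a \<in> A \<Longrightarrow> definable (Q a)) \<Longrightarrow> definable (\<lambda>x. \<forall>a\<in>A. Q a x)"
  by (induction A rule: finite_induct) (auto intro: definable_conj definable_const)

lemma definable_bex:
  assumes "finite A" "\<And>a. a \<in> A \<Longrightarrow> definable (Q a)"
  shows "definable (\<lambda>x. \<exists>a\<in>A. Q a x)"
  using definable_Not[OF definable_ball[OF assms(1), of "\<lambda>a x. \<not> Q a x"]] definable_Not assms(2) by auto

lemma definable_iff_const: "definable Q \<Longrightarrow> definable (\<lambda>x. c \<longleftrightarrow> Q x)"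
  by (cases c) (auto intro: definable_Not)

lemma definable_Dia: "definable Q \<Longrightarrow> definable (\<lambda>x. \<exists>y. le x y \<and> Q y)"
  unfolding definable_def
  by (metis (no_types, lifting) L_Box L_Neg le_mcs(2) mcs_Dia)

section \<open>Semantic forms of (Fix), (Ind) and (C)\<close>

lemma tangle_Fix:
  assumes "mcs x" "Tangle \<Gamma> \<in> x" "\<gamma> |\<in>| \<Gamma>"
  obtains y where "le x y" "\<gamma> \<in> y" "Tangle \<Gamma> \<in> y"
proof -
  have L: "Tangle \<Gamma> \<in> L" "\<gamma> \<in> L" using assms mcs_subset L_Tangle by blast+
  then have "Dia (\<gamma> \<^bold>\<and> Tangle \<Gamma>) \<in> x"
    using mcs_axiom_Imp[OF _ disjI2[OF Fix]] assms by simp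
  then obtain y where "le x y" "\<gamma> \<^bold>\<and> Tangle \<Gamma> \<in> y" using mcs_Dia[of x "\<gamma> \<^bold>\<and> Tangle \<Gamma>"] assms L by auto
  then show thesis using that mcs_And le_mcs by blast
qed

text \<open>A coinduction principle: a definable property that reproduces itself together with each
  member of \<open>\<Gamma>\<close> forces the tangle. Since the premise of (Ind) is boxed,
  reproduction is required only at points above \<open>x\<close>, which is what makes it usable at
  final points.\<close>

lemma tangle_Ind:
  assumes "mcs x" "Tangle \<Gamma> \<in> L" "definable Q" "Q x"
    and step: "\<And>y \<gamma>. le x y \<Longrightarrow> Q y \<Longrightarrow> \<gamma> |\<in>| \<Gamma> \<Longrightarrow> \<exists>z. le y z \<and> \<gamma> \<in> z \<and> Q z"
  shows "Tangle \<Gamma> \<in> x"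
proof -
  obtain \<phi> where \<phi>: "\<phi> \<in> L" "\<And>x. mcs x \<Longrightarrow> \<phi> \<in> x \<longleftrightarrow> Q x"
    using assms(3) by (auto simp: definable_def)
  obtain \<gamma>s where \<gamma>s: "fset_of_list \<gamma>s = \<Gamma>" using exists_fset_of_list by blast
  then have set: "set \<gamma>s = fset \<Gamma>" by (auto simp: fset_of_list.rep_eq)
  have L: "\<gamma> \<in> L" if "\<gamma> \<in> set \<gamma>s" for \<gamma> using that set L_Tangle assms(2) by blast
  let ?c = "Conj (map (\<lambda>\<gamma>. Dia (\<gamma> \<^bold>\<and> \<phi>)) \<gamma>s)"
  have cL: "?c \<in> L" using L \<phi> by auto
  have "\<phi> \<^bold>\<rightarrow> ?c \<in> y" if xy: "le x y" for y
  proof -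
    have y: "mcs y" using that le_mcs by blast
    show ?thesis
      unfolding mcs_Imp[OF y \<phi>(1) cL] mcs_Conj[OF y]
    proof (intro impI subsetI)
      fix \<theta> assume *: "\<phi> \<in> y" "\<theta> \<in> set (map (\<lambda>\<gamma>. Dia (\<gamma> \<^bold>\<and> \<phi>)) \<gamma>s)"
      then obtain \<gamma> where \<gamma>: "\<gamma> \<in> set \<gamma>s" "\<theta> = Dia (\<gamma> \<^bold>\<and> \<phi>)" by auto
      then obtain z where "le y z" "\<gamma> \<in> z" "Q z" using step[OF xy] \<phi> y *(1) set by blast
      then show "\<theta> \<in> y"
        unfolding \<gamma>(2) using mcs_Dia[OF y, of "\<gamma> \<^bold>\<and> \<phi>"] L[OF \<gamma>(1)] \<phi> le_mcs mcs_And by auto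
    qed
  qed
  then have "Box_star (\<phi> \<^bold>\<rightarrow> ?c) \<in> x"
    using mcs_And[OF assms(1)] mcs_Box[OF assms(1), of "\<phi> \<^bold>\<rightarrow> ?c"] le_refl[OF assms(1)] \<phi>(1) cL by simp
  then have "\<phi> \<^bold>\<rightarrow> Tangle \<Gamma> \<in> x"
    using mcs_axiom_Imp[OF assms(1) disjI2[OF Ind[OF \<gamma>s, of \<phi>]]] \<phi>(1) assms(2) by simp
  then show ?thesis using mcs_Imp assms \<phi> by blast
qed

text \<open>Coinduction with the property of lying below a point that contains the tangle; (Fix) at
  that point supplies the next witness.\<close>

lemma tangle_le:
  assumes "le x y" "Tangle \<Gamma> \<in> y"
  shows "Tangle \<Gamma> \<in> x"
proof (rule tangle_Ind)
  show L: "Tangle \<Gamma> \<in> L" using assms le_mcs mcs_subset by blast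
  show "definable (\<lambda>x. \<exists>y. le x y \<and> Tangle \<Gamma> \<in> y)" by (intro definable_Dia definable_mem L)
  show "\<exists>y. le x y \<and> Tangle \<Gamma> \<in> y" using assms by blast
next
  fix z \<gamma> assume z: "\<exists>y. le z y \<and> Tangle \<Gamma> \<in> y" "\<gamma> |\<in>| \<Gamma>"
  then obtain u where u: "le z u" "Tangle \<Gamma> \<in> u" by blast
  obtain v where "le u v" "\<gamma> \<in> v" "Tangle \<Gamma> \<in> v" using tangle_Fix[OF le_mcs(2)[OF u(1)] u(2) z(2)] .
  then show "\<exists>v. le z v \<and> \<gamma> \<in> v \<and> (\<exists>y. le v y \<and> Tangle \<Gamma> \<in> y)"
    using le_trans[OF u(1)] le_refl le_mcs by blast
qed (use assms le_mcs in auto)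

text \<open>Invariance along \<open>le\<close> in both directions makes the defining formula or its
  negation hold together with its box at every point of the class of \<open>x0\<close>, which is the
  premise of (C).\<close>

lemma sim_connected:
  assumes "mcs x0" "definable Q" "\<And>x y. sim x0 x \<Longrightarrow> le x y \<Longrightarrow> Q x \<longleftrightarrow> Q y"
    and "sim x0 x" "Q x" "sim x0 y"
  shows "Q y"
proof -
  obtain \<phi> where \<phi>: "\<phi> \<in> L" "\<And>x. mcs x \<Longrightarrow> \<phi> \<in> x \<longleftrightarrow> Q x"
    using assms(2) by (auto simp: definable_def)
  have "Box_star \<phi> \<^bold>\<or> Box_star (Neg \<phi>) \<in> z" if "sim x0 z" for z
  proof -
    have z: "mcs z" using that sim_mcs by blast
    have "\<phi> \<in> w \<longleftrightarrow> \<phi> \<in> z" if "le z w" for w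
      using assms(3)[OF \<open>sim x0 z\<close> that] \<phi>(2) le_mcs[OF that] by blast
    then show ?thesis
      using \<phi>(1) z by (auto simp: mcs_Neg mcs_And mcs_Box le_mcs)
  qed
  then have "Univ (Box_star \<phi> \<^bold>\<or> Box_star (Neg \<phi>)) \<in> x0"
    using mcs_Univ[OF assms(1)] \<phi>(1) by simp
  then have "Univ \<phi> \<^bold>\<or> Univ (Neg \<phi>) \<in> x0"
    using mcs_axiom_Imp[OF assms(1) disjI1[OF C]] \<phi>(1) by simp
  then have "Univ \<phi> \<in> x0 \<or> Univ (Neg \<phi>) \<in> x0"
    using \<phi>(1) assms(1) by (auto simp: mcs_Neg mcs_And)
  then have "\<phi> \<in> y"
    using assms(4-6) \<phi> sim_mcs[OF assms(4)] by (auto simp: sim_def mcs_Neg)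
  then show ?thesis using \<phi> sim_mcs[OF assms(6)] by blast
qed

end

subsection \<open>Subformulas\<close>

fun subf :: "'v fm \<Rightarrow> 'v fm set" where
  "subf (Atom p) = {Atom p}"
| "subf Top = {Top}"
| "subf (Neg \<phi>) = insert (Neg \<phi>) (subf \<phi>)"
| "subf (\<phi> \<^bold>\<and> \<psi>) = insert (\<phi> \<^bold>\<and> \<psi>) (subf \<phi> \<union> subf \<psi>)"
| "subf (Box \<phi>) = insert (Box \<phi>) (subf \<phi>)"
| "subf (Univ \<phi>) = insert (Univ \<phi>) (subf \<phi>)"
| "subf (Tangle \<Delta>) = insert (Tangle \<Delta>) (\<Union>\<delta>\<in>fset \<Delta>. subf \<delta>)"

lemma subf_refl: "\<phi> \<in> subf \<phi>"
  by (cases \<phi>) auto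

lemma finite_subf: "finite (subf \<phi>)"
  by (induction \<phi>) auto

lemma subf_trans: "\<psi> \<in> subf \<phi> \<Longrightarrow> subf \<psi> \<subseteq> subf \<phi>"
  by (induction \<phi>) auto

lemma subf_closed:
  "Neg \<psi> \<in> subf \<phi> \<Longrightarrow> \<psi> \<in> subf \<phi>"
  "\<psi> \<^bold>\<and> \<theta> \<in> subf \<phi> \<Longrightarrow> \<psi> \<in> subf \<phi> \<and> \<theta> \<in> subf \<phi>"
  "Box \<psi> \<in> subf \<phi> \<Longrightarrow> \<psi> \<in> subf \<phi>"
  "Univ \<psi> \<in> subf \<phi> \<Longrightarrow> \<psi> \<in> subf \<phi>"
  "Tangle \<Delta> \<in> subf \<phi> \<Longrightarrow> \<delta> |\<in>| \<Delta> \<Longrightarrow> \<delta> \<in> subf \<phi>"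
  using subf_trans[of _ \<phi>] subf_refl by fastforce+

subsection \<open>A refined filtration\<close>

text \<open>
  A node consists of the type of a point \<open>x\<close> and the set \<open>seen x\<close> of types of points above \<open>x\<close>. On
  the points with a fixed value \<open>T\<close> of \<open>seen\<close>, the set \<open>level x\<close> of types realised higher up with the
  same \<open>T\<close> can still shrink; the points where this no longer happens (\<open>final\<close>) form the proper
  clusters, and below them every type of a point with \<open>seen x = T\<close> is also a singleton cluster.
  For final points \<open>Ind\<close>, applied to the formula defining \<open>T\<close>, shows that a cluster only satisfies
  the tangles that its points contain.
\<close>

type_synonym 'v node = "'v fm set \<times> 'v fm set set \<times> 'v fm set set option"

text \<open>A node without a level lies below every leveled node with the same seen set, whether or
  not its point sees such a cluster. This is harmless for \<open>Box\<close>, whose truth depends on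
  the seen set alone, and it ties all nodes with one seen set together. Leveled nodes with the same
  seen set but different levels are incomparable.\<close>

definition node_le :: "'v node \<Rightarrow> 'v node \<Rightarrow> bool" where
  "node_le n m \<longleftrightarrow> (case (n, m) of ((w, T, d), (w', T', d')) \<Rightarrow>
    T' \<subset> T \<or> T' = T \<and> (d = None \<and> d' \<noteq> None \<or> d = d' \<and> (d = None \<longrightarrow> w = w')))"

lemma node_le_refl: "node_le n n"
  by (auto simp: node_le_def split: prod.splits)

lemma node_le_trans: "node_le n m \<Longrightarrow> node_le m k \<Longrightarrow> node_le n k"
  by (auto simp: node_le_def split: prod.splits)

locale filtration = tangle_logic L for L :: "'v fm set" +
  fixes x0 :: "'v fm set" and \<phi>0 :: "'v fm"
  assumes x0: "mcs x0" and \<phi>0: "\<phi>0 \<in> L"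
begin

abbreviation \<Sigma> :: "'v fm set" where "\<Sigma> \<equiv> subf \<phi>0"

lemma \<Sigma>_L: "\<Sigma> \<subseteq> L"
proof -
  have "\<phi> \<in> L \<Longrightarrow> subf \<phi> \<subseteq> L" for \<phi>
    by (induction \<phi>) (auto dest: L_Tangle)
  then show ?thesis using \<phi>0 .
qed

definition tp :: "'v fm set \<Rightarrow> 'v fm set" where
  "tp x = x \<inter> \<Sigma>"

definition seen :: "'v fm set \<Rightarrow> 'v fm set set" where
  "seen x = {tp y |y. le x y}"

definition level :: "'v fm set \<Rightarrow> 'v fm set set" where
  "level x = {tp y |y. le x y \<and> seen y = seen x}"

definition final :: "'v fm set \<Rightarrow> bool" where
  "final x \<longleftrightarrow> (\<forall>y. le x y \<and> seen y = seen x \<longrightarrow> level y = level x)"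

definition P :: "'v fm set set" where
  "P = {x. sim x0 x}"

definition low :: "'v fm set \<Rightarrow> 'v node" where
  "low x = (tp x, seen x, None)"

definition high :: "'v fm set \<Rightarrow> 'v node" where
  "high x = (tp x, seen x, Some (level x))"

definition nodes :: "'v node set" where
  "nodes = low ` P \<union> high ` {x\<in>P. final x}"

section \<open>Seen sets, levels and final points\<close>

lemma P_mcs: "x \<in> P \<Longrightarrow> mcs x"
  by (auto simp: P_def sim_mcs)

lemma P_le: "x \<in> P \<Longrightarrow> le x y \<Longrightarrow> y \<in> P"
  unfolding P_def using sim_trans le_sim by blast

lemma x0_P: "x0 \<in> P"
  by (simp add: P_def sim_refl x0)

lemma seen_mono: "le x y \<Longrightarrow> seen y \<subseteq> seen x"
  unfolding seen_def using le_trans by blast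

lemma tp_seen: "mcs x \<Longrightarrow> tp x \<in> seen x"
  unfolding seen_def using le_refl by blast

lemma level_mono: "le x y \<Longrightarrow> seen y = seen x \<Longrightarrow> level y \<subseteq> level x"
  unfolding level_def using le_trans by auto

lemma seen_Pow: "seen x \<subseteq> Pow \<Sigma>"
  by (auto simp: seen_def tp_def)

lemma finite_seen: "finite (seen x)"
  using seen_Pow finite_subf finite_subset by blast

lemma finite_level: "finite (level x)"
  by (rule finite_subset[OF _ finite_seen[of x]]) (auto simp: level_def seen_def)

lemma finite_nodes: "finite nodes"
proof -
  have "level x \<subseteq> Pow \<Sigma>" for x by (auto simp: level_def tp_def)
  then have "nodes \<subseteq> Pow \<Sigma> \<times> Pow (Pow \<Sigma>) \<times> insert None (Some ` Pow (Pow \<Sigma>))"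
    using seen_Pow by (fastforce simp: nodes_def low_def high_def tp_def)
  then show ?thesis by (rule finite_subset) (simp add: finite_subf)
qed

lemma nodes_cases:
  assumes "n \<in> nodes"
  obtains (low) x where "x \<in> P" "n = low x" | (high) x where "x \<in> P" "final x" "n = high x"
  using assms by (auto simp: nodes_def)

lemma node_point:
  assumes "n \<in> nodes"
  obtains x where "x \<in> P" "fst n = tp x" "fst (snd n) = seen x" "snd (snd n) \<noteq> None \<Longrightarrow> final x \<and> n = high x"
  using assms by (cases rule: nodes_cases) (auto simp: low_def high_def)

text \<open>Along points with the same seen set the finite set \<open>level\<close> can only shrink,
  so a point of smallest level is final.\<close>

lemma final_seen:
  assumes "mcs x"
  obtains v where "le x v" "seen v = seen x" "final v"
proof -
  let ?Q = "\<lambda>y. le x y \<and> seen y = seen x"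
  obtain v where v: "?Q v" and min: "\<And>y. ?Q y \<Longrightarrow> card (level v) \<le> card (level y)"
    using ex_has_least_nat[of ?Q x "\<lambda>y. card (level y)"] le_refl[OF assms] by blast
  have "level y = level v" if "le v y" "seen y = seen v" for y
  proof (rule card_seteq)
    show "level y \<subseteq> level v" using level_mono that by blast
    show "card (level v) \<le> card (level y)" using min that v le_trans by metis
  qed (rule finite_level)
  then show thesis using that v by (auto simp: final_def)
qed

lemma final_mono:
  assumes "final x" "le x y" "seen y = seen x"
  shows "final y" "level y = level x"
proof -
  show *: "level y = level x" using assms by (auto simp: final_def)
  show "final y" unfolding final_def using assms * le_trans by (metis final_def)
qed

text \<open>A point above \<open>x\<close> either keeps the seen set, and by finality lands in the
  cluster of \<open>high x\<close>, or has a strictly smaller one, and then its \<open>low\<close>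
  node is strictly above.\<close>

lemma high_witness:
  assumes "x \<in> P" "final x" "t \<in> seen x"
  obtains m where "m \<in> nodes" "node_le (high x) m" "fst m = t"
proof -
  obtain y where y: "le x y" "tp y = t" using assms(3) by (auto simp: seen_def)
  have yP: "y \<in> P" using P_le assms y by blast
  show thesis
  proof (cases "seen y = seen x")
    case True
    note f = final_mono[OF assms(2) y(1) True]
    have "high y \<in> nodes" using yP f by (auto simp: nodes_def)
    moreover have "node_le (high x) (high y)" using True f by (simp add: node_le_def high_def)
    ultimately show ?thesis using that y by (auto simp: high_def)
  next
    case False
    then have "node_le (high x) (low y)" using seen_mono[OF y(1)] by (auto simp: node_le_def high_def low_def)
    moreover have "low y \<in> nodes" using yP by (auto simp: nodes_def)
    ultimately show ?thesis using that y by (auto simp: low_def)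
  qed
qed

lemma node_witness:
  assumes "n \<in> nodes" "t \<in> fst (snd n)"
  obtains m where "m \<in> nodes" "node_le n m" "fst m = t"
  using assms(1)
proof (cases rule: nodes_cases)
  case (high x)
  then show ?thesis using high_witness[of x t] assms(2) that by (auto simp: high_def)
next
  case (low x)
  obtain v where v: "le x v" "seen v = seen x" "final v" using final_seen P_mcs low by blast
  have "node_le n (high v)" using low v by (simp add: node_le_def low_def high_def)
  moreover obtain m where "m \<in> nodes" "node_le (high v) m" "fst m = t"
    using high_witness[of v t] P_le[OF low(1) v(1)] v low(2) assms(2) by (auto simp: low_def)
  ultimately show ?thesis using that node_le_trans by blast
qed

text \<open>Converse of \<open>node_witness\<close>: the types of the nodes above \<open>n\<close>
  are exactly the members of the seen set stored in \<open>n\<close>.\<close>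

lemma node_le_seen:
  assumes "m \<in> nodes" "node_le n m"
  shows "fst m \<in> fst (snd n)"
proof -
  obtain y where "y \<in> P" "fst m = tp y" "fst (snd m) = seen y" using node_point assms(1) by metis
  then have "fst m \<in> fst (snd m)" using tp_seen P_mcs by auto
  moreover have "fst (snd m) \<subseteq> fst (snd n)" using assms(2) by (auto simp: node_le_def split: prod.splits)
  ultimately show ?thesis by blast
qed

section \<open>Truth conditions for the modalities at nodes\<close>

lemma node_Box:
  assumes "n \<in> nodes" "Box \<psi> \<in> \<Sigma>"
  shows "Box \<psi> \<in> fst n \<longleftrightarrow> (\<forall>m\<in>nodes. node_le n m \<longrightarrow> \<psi> \<in> fst m)"
proof -
  obtain x where x: "x \<in> P" "fst n = tp x" "fst (snd n) = seen x" using node_point assms(1) by metis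
  have \<psi>: "\<psi> \<in> L" "\<psi> \<in> \<Sigma>" using assms(2) subf_closed \<Sigma>_L by blast+
  have "Box \<psi> \<in> fst n \<longleftrightarrow> (\<forall>t\<in>seen x. \<psi> \<in> t)"
    using x(2) assms(2) \<psi> mcs_Box[OF P_mcs[OF x(1)] \<psi>(1)] by (auto simp: seen_def tp_def)
  also have "\<dots> \<longleftrightarrow> (\<forall>m\<in>nodes. node_le n m \<longrightarrow> \<psi> \<in> fst m)"
    using node_witness[OF assms(1)] node_le_seen x(3) by metis
  finally show ?thesis .
qed

lemma node_Univ:
  assumes "n \<in> nodes" "Univ \<psi> \<in> \<Sigma>"
  shows "Univ \<psi> \<in> fst n \<longleftrightarrow> (\<forall>m\<in>nodes. \<psi> \<in> fst m)"
proof -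
  obtain x where x: "x \<in> P" "fst n = tp x" using node_point assms(1) by metis
  have \<psi>: "\<psi> \<in> L" "\<psi> \<in> \<Sigma>" using assms(2) subf_closed \<Sigma>_L by blast+
  have "P = {y. sim x y}" using x(1) sim_trans sim_sym unfolding P_def by blast
  then have "Univ \<psi> \<in> fst n \<longleftrightarrow> (\<forall>y\<in>P. \<psi> \<in> tp y)"
    using x assms(2) \<psi> mcs_Univ[OF P_mcs[OF x(1)] \<psi>(1)] by (auto simp: tp_def)
  also have "\<dots> \<longleftrightarrow> (\<forall>m\<in>nodes. \<psi> \<in> fst m)"
    by (auto simp: nodes_def low_def high_def ball_Un)
  finally show ?thesis .
qed

text \<open>With \<open>\<Sigma>\<close> finite, each type has a characteristic formula, and a seen
  set is described by stating for each possible type whether a point above realises it. A set that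
  is not a set of types is never a seen set.\<close>

lemma definable_seen: "definable (\<lambda>x. seen x = T)"
proof (cases "T \<subseteq> Pow \<Sigma>")
  case True
  have tp: "definable (\<lambda>x. \<forall>\<psi>\<in>\<Sigma>. (\<psi> \<in> t) \<longleftrightarrow> (\<psi> \<in> x))" for t
    using \<Sigma>_L by (intro definable_ball finite_subf definable_iff_const definable_mem) auto
  have "definable (\<lambda>x. \<forall>t\<in>Pow \<Sigma>. (t \<in> T) \<longleftrightarrow> (\<exists>y. le x y \<and> (\<forall>\<psi>\<in>\<Sigma>. (\<psi> \<in> t) \<longleftrightarrow> (\<psi> \<in> y))))"
    by (rule definable_ball, simp add: finite_subf, intro definable_iff_const definable_Dia tp)
  moreover have "(\<forall>\<psi>\<in>\<Sigma>. (\<psi> \<in> t) \<longleftrightarrow> (\<psi> \<in> y)) \<longleftrightarrow> t = tp y" if "t \<in> Pow \<Sigma>" for t y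
    using that by (auto simp: tp_def)
  then have "(\<exists>y. le x y \<and> (\<forall>\<psi>\<in>\<Sigma>. (\<psi> \<in> t) \<longleftrightarrow> (\<psi> \<in> y))) \<longleftrightarrow> t \<in> seen x" if "t \<in> Pow \<Sigma>" for t x
    using that unfolding seen_def mem_Collect_eq by (metis (no_types, lifting))
  then have "(\<forall>t\<in>Pow \<Sigma>. (t \<in> T) \<longleftrightarrow> (\<exists>y. le x y \<and> (\<forall>\<psi>\<in>\<Sigma>. (\<psi> \<in> t) \<longleftrightarrow> (\<psi> \<in> y)))) \<longleftrightarrow>
      (\<forall>t\<in>Pow \<Sigma>. (t \<in> T) \<longleftrightarrow> t \<in> seen x)" for x
    by (intro ball_cong refl) simp
  moreover have "(\<forall>t\<in>Pow \<Sigma>. (t \<in> T) \<longleftrightarrow> t \<in> seen x) \<longleftrightarrow> seen x = T" for x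
    using True seen_Pow[of x] by blast
  ultimately show ?thesis by simp
next
  case False
  then have "(\<lambda>x. seen x = T) = (\<lambda>x. False)" using seen_Pow by blast
  then show ?thesis using definable_const[of False] by simp
qed

lemma node_Tangle_introduce:
  assumes m: "m \<in> nodes" and \<Gamma>: "Tangle \<Gamma> \<in> \<Sigma>"
    and cluster: "\<And>\<gamma>. \<gamma> |\<in>| \<Gamma> \<Longrightarrow> \<exists>k\<in>nodes. node_le m k \<and> node_le k m \<and> \<gamma> \<in> fst k"
  shows "Tangle \<Gamma> \<in> fst m"
proof -
  have L: "Tangle \<Gamma> \<in> L" using \<Gamma> \<Sigma>_L by blast
  obtain x where x: "x \<in> P" "fst m = tp x" "fst (snd m) = seen x"
    and fin: "snd (snd m) \<noteq> None \<Longrightarrow> final x \<and> m = high x"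
    using node_point[OF m] by metis
  note mx = P_mcs[OF x(1)]
  have "Tangle \<Gamma> \<in> x"
  proof (cases "snd (snd m)")
    case None
    \<comment> \<open>A node without a level is alone in its cluster, so its type contains all of
      \<open>\<Gamma>\<close>. Every point containing \<open>\<Gamma>\<close> is its own next
      witness, and the conjunction of \<open>\<Gamma>\<close> serves as the property for
      (Ind).\<close>
    have k: "fst k = fst m" if "node_le m k" "node_le k m" for k
      using that None by (auto simp: node_le_def split: prod.splits)
    show ?thesis
    proof (rule tangle_Ind[OF mx L])
      show "definable (\<lambda>y. \<forall>\<gamma>\<in>fset \<Gamma>. \<gamma> \<in> y)"
        using L L_Tangle by (intro definable_ball definable_mem) auto
      show "\<forall>\<gamma>\<in>fset \<Gamma>. \<gamma> \<in> x" using cluster k x(2) by (fastforce simp: tp_def)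
    qed (use le_refl le_mcs in blast)
  next
    case (Some d)
    then have f: "final x" "m = high x" using fin by auto
    show ?thesis
    proof (rule tangle_Ind[OF mx L definable_seen[of "seen x"] refl])
      \<comment> \<open>By finality \<open>y\<close> has the level of \<open>x\<close>, which the
        nodes of the cluster share. The type of the cluster node containing \<open>\<gamma>\<close>
        is in that level, so it recurs above \<open>y\<close> with the seen set unchanged.\<close>
      fix y \<gamma> assume y: "le x y" "seen y = seen x" "\<gamma> |\<in>| \<Gamma>"
      obtain k where k: "k \<in> nodes" "node_le m k" "node_le k m" "\<gamma> \<in> fst k" using cluster y(3) by blast
      have "snd (snd k) = snd (snd m)"
        using k(2,3) f by (auto simp: node_le_def high_def split: prod.splits)
      then have "snd (snd k) = Some (level x)" using f by (simp add: high_def)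
      moreover then obtain z where z: "z \<in> P" "k = high z" using node_point[OF k(1)] by (metis option.distinct(1))
      ultimately have "level z = level x" by (simp add: high_def)
      moreover have "tp z \<in> level z" using le_refl P_mcs z(1) by (auto simp: level_def)
      ultimately have "tp z \<in> level y" using final_mono[OF f(1) y(1,2)] by simp
      then obtain u where "le y u" "seen u = seen y" "tp u = tp z" by (auto simp: level_def)
      moreover have "\<gamma> \<in> tp z" using k(4) z(2) by (simp add: high_def)
      ultimately show "\<exists>u. le y u \<and> \<gamma> \<in> u \<and> seen u = seen x" using y by (auto simp: tp_def)
    qed
  qed
  then show ?thesis using x(2) \<Gamma> by (simp add: tp_def)
qed

lemma node_Tangle_eliminate:
  assumes n: "n \<in> nodes" and \<Gamma>: "Tangle \<Gamma> \<in> fst n"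
  obtains m where "m \<in> nodes" "node_le n m"
    "\<And>\<gamma>. \<gamma> |\<in>| \<Gamma> \<Longrightarrow> \<exists>k\<in>nodes. node_le m k \<and> node_le k m \<and> \<gamma> \<in> fst k"
proof -
  obtain x where x: "x \<in> P" "fst n = tp x" "fst (snd n) = seen x"
    and fin: "snd (snd n) \<noteq> None \<Longrightarrow> final x \<and> n = high x"
    using node_point[OF n] by metis
  note mx = P_mcs[OF x(1)]
  have \<Gamma>: "Tangle \<Gamma> \<in> \<Sigma>" "Tangle \<Gamma> \<in> x" using \<Gamma> x(2) by (auto simp: tp_def)
  \<comment> \<open>Minimality of the seen set keeps the witnesses supplied by (Fix) from leaving
    it: they contain the tangle again, so their seen set cannot be smaller.\<close>
  let ?Q = "\<lambda>y. le x y \<and> Tangle \<Gamma> \<in> y"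
  obtain y where y: "?Q y" and min: "\<And>z. ?Q z \<Longrightarrow> card (seen y) \<le> card (seen z)"
    using ex_has_least_nat[of ?Q x "\<lambda>y. card (seen y)"] le_refl[OF mx] \<Gamma> by blast
  have my: "mcs y" using y le_mcs by blast
  obtain v where v: "le y v" "seen v = seen y" "final v" using final_seen[OF my] .
  have xv: "le x v" using le_trans y v by blast
  \<comment> \<open>The tangle passes up from \<open>y\<close> to \<open>v\<close>: as the seen sets
    agree, the type of \<open>y\<close> recurs above \<open>v\<close>, and \<open>tangle_le\<close>
    brings the tangle back down to \<open>v\<close>.\<close>
  have "tp y \<in> seen v" using tp_seen[OF my] v(2) by simp
  then obtain y' where y': "le v y'" "tp y' = tp y" by (auto simp: seen_def)
  then have "Tangle \<Gamma> \<in> y'" using y \<Gamma> by (auto simp: tp_def)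
  then have v\<Gamma>: "Tangle \<Gamma> \<in> v" using tangle_le y' by blast
  have vn: "high v \<in> nodes" using P_le[OF x(1) xv] v(3) by (auto simp: nodes_def)
  have "node_le n (high v)"
  proof (cases "seen v = seen x")
    case True
    show ?thesis
    proof (cases "snd (snd n)")
      case None
      then show ?thesis using x(3) True by (auto simp: node_le_def high_def split: prod.splits)
    next
      case (Some d)
      then have f: "final x" "n = high x" using fin by auto
      then show ?thesis using final_mono(2)[OF f(1) xv True] True by (simp add: node_le_def high_def)
    qed
  next
    case False
    then show ?thesis
      using seen_mono[OF xv] x(3) by (auto simp: node_le_def high_def split: prod.splits)
  qed
  moreover have "\<exists>k\<in>nodes. node_le (high v) k \<and> node_le k (high v) \<and> \<gamma> \<in> fst k" if \<gamma>: "\<gamma> |\<in>| \<Gamma>" for \<gamma>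
  proof -
    obtain u where u: "le v u" "\<gamma> \<in> u" "Tangle \<Gamma> \<in> u" using tangle_Fix[OF le_mcs(2)[OF xv] v\<Gamma> \<gamma>] .
    have xu: "le x u" using le_trans xv u by blast
    have "seen u = seen v"
    proof (rule card_seteq)
      show "seen u \<subseteq> seen v" using seen_mono u by blast
      show "card (seen v) \<le> card (seen u)" using min xu u v(2) by simp
    qed (rule finite_seen)
    note eq = this final_mono[OF v(3) u(1) this]
    have "high u \<in> nodes" using P_le[OF x(1) xu] eq by (auto simp: nodes_def)
    moreover have "\<gamma> \<in> tp u" using u(2) subf_closed(5)[OF \<Gamma>(1) \<gamma>] by (simp add: tp_def)
    ultimately show ?thesis using eq by (intro bexI[of _ "high u"]) (auto simp: node_le_def high_def)
  qed
  ultimately show thesis using that vn by blast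
qed

lemma node_Tangle:
  assumes "n \<in> nodes" "Tangle \<Gamma> \<in> \<Sigma>"
  shows "Tangle \<Gamma> \<in> fst n \<longleftrightarrow> (\<exists>m\<in>nodes. node_le n m \<and>
    (\<forall>\<gamma>. \<gamma> |\<in>| \<Gamma> \<longrightarrow> (\<exists>k\<in>nodes. node_le m k \<and> node_le k m \<and> \<gamma> \<in> fst k)))"
proof
  assume "\<exists>m\<in>nodes. node_le n m \<and>
    (\<forall>\<gamma>. \<gamma> |\<in>| \<Gamma> \<longrightarrow> (\<exists>k\<in>nodes. node_le m k \<and> node_le k m \<and> \<gamma> \<in> fst k))"
  then obtain m where m: "m \<in> nodes" "node_le n m" "Tangle \<Gamma> \<in> fst m"
    using node_Tangle_introduce assms(2) by blast
  obtain x where x: "x \<in> P" "fst n = tp x" "fst (snd n) = seen x" using node_point assms(1) by metis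
  have "fst m \<in> seen x" using node_le_seen[OF m(1,2)] x(3) by simp
  then obtain y where "le x y" "tp y = fst m" by (auto simp: seen_def)
  then have "Tangle \<Gamma> \<in> x" using m(3) tangle_le by (auto simp: tp_def)
  then show "Tangle \<Gamma> \<in> fst n" using x(2) assms(2) by (simp add: tp_def)
qed (use node_Tangle_eliminate[OF assms(1)] in metis)

text \<open>A set of nodes closed under \<open>node_le\<close> in both directions is determined by
  the seen sets occurring in it, hence is definable on points and falls under
  \<open>sim_connected\<close>.\<close>

lemma nodes_connected:
  assumes A: "A \<subseteq> nodes" "A \<noteq> {}"
    and closed: "\<And>m n. m \<in> nodes \<Longrightarrow> n \<in> nodes \<Longrightarrow> node_le m n \<Longrightarrow> m \<in> A \<longleftrightarrow> n \<in> A"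
  shows "A = nodes"
proof -
  have low_in: "low x \<in> nodes" if "x \<in> P" for x using that by (auto simp: nodes_def)
  have same: "n \<in> A \<longleftrightarrow> m \<in> A"
    if n: "n \<in> nodes" and m: "m \<in> nodes" and eq: "fst (snd n) = fst (snd m)" for m n
  proof -
    obtain x where x: "x \<in> P" "fst n = tp x" "fst (snd n) = seen x" using node_point n by metis
    obtain v where v: "le x v" "seen v = seen x" "final v" using final_seen P_mcs x(1) by blast
    have hv: "high v \<in> nodes" using P_le[OF x(1) v(1)] v(3) by (auto simp: nodes_def)
    \<comment> \<open>Nodes with this seen set all reach \<open>high v\<close>: those without a
      level directly, the leveled ones by going down to \<open>low x\<close> and up again.\<close>
    have hub: "k \<in> A \<longleftrightarrow> high v \<in> A" if k: "k \<in> nodes" "fst (snd k) = seen x" for k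
    proof (cases "snd (snd k)")
      case None
      then have "node_le k (high v)" using k v by (auto simp: node_le_def high_def split: prod.splits)
      then show ?thesis using closed k hv by blast
    next
      case (Some d)
      obtain w T c where "k = (w, T, c)" using prod_cases3 .
      then have "node_le (low x) k" using k(2) Some by (simp add: node_le_def low_def)
      moreover have "node_le (low x) (high v)" using v by (simp add: node_le_def high_def low_def)
      ultimately show ?thesis using closed[OF low_in[OF x(1)]] k(1) hv by metis
    qed
    show ?thesis using hub[OF n x(3)] hub[OF m] eq x(3) by simp
  qed
  \<comment> \<open>Finitely many nodes give finitely many seen sets, so this is a finite
    disjunction of definable properties. Steps along \<open>le\<close> that change the seen set are
    steps between \<open>low\<close> nodes.\<close>
  let ?Q = "\<lambda>x. \<exists>T\<in>(fst \<circ> snd) ` A. seen x = T"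
  have Q: "?Q x \<longleftrightarrow> low x \<in> A" if x: "x \<in> P" for x
  proof
    assume "?Q x"
    then obtain n where n: "n \<in> A" "seen x = fst (snd n)" by auto
    have "n \<in> nodes" using n A by blast
    from same[OF this low_in[OF x]] n show "low x \<in> A" by (simp add: low_def)
  qed (force simp: low_def image_iff)
  have "definable ?Q"
    using finite_nodes A(1) finite_subset by (intro definable_bex definable_seen finite_imageI) blast
  moreover have "?Q x \<longleftrightarrow> ?Q y" if "sim x0 x" "le x y" for x y
  proof (cases "seen y = seen x")
    case False
    have xy: "x \<in> P" "y \<in> P" using that P_le by (auto simp: P_def)
    have "node_le (low x) (low y)" using False seen_mono[OF that(2)] by (auto simp: node_le_def low_def)
    then show ?thesis
      unfolding Q[OF xy(1)] Q[OF xy(2)] by (rule closed[OF low_in[OF xy(1)] low_in[OF xy(2)]])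
  qed simp
  moreover obtain n where n: "n \<in> A" using A(2) by blast
  obtain x where x: "x \<in> P" "fst (snd n) = seen x" using node_point n A(1) by (metis subsetD)
  have "?Q x" using n x(2) by force
  ultimately have all: "?Q y" if "y \<in> P" for y
    using sim_connected[OF x0, of ?Q x y] x(1) that unfolding P_def by blast
  have "m \<in> A" if m: "m \<in> nodes" for m
  proof -
    obtain y where y: "y \<in> P" "fst (snd m) = seen y" using node_point m by metis
    have "low y \<in> A" using Q[OF y(1)] all[OF y(1)] by blast
    then show ?thesis using same[OF m low_in[OF y(1)]] y(2) by (simp add: low_def)
  qed
  then show ?thesis using A(1) by blast
qed

end

subsection \<open>Dissections of open sets\<close>

lemma maximal_separated_set:
  fixes U :: "'a::metric_space set"
  assumes "\<epsilon> > 0"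
  obtains Z where "Z \<subseteq> U" "\<And>a b. a \<in> Z \<Longrightarrow> b \<in> Z \<Longrightarrow> a \<noteq> b \<Longrightarrow> \<epsilon> \<le> dist a b"
    "\<And>y. y \<in> U \<Longrightarrow> \<exists>z\<in>Z. dist y z < \<epsilon>"
proof -
  let ?F = "{Z. Z \<subseteq> U \<and> (\<forall>a\<in>Z. \<forall>b\<in>Z. a \<noteq> b \<longrightarrow> \<epsilon> \<le> dist a b)}"
  have "\<exists>M\<in>?F. \<forall>X\<in>?F. M \<subseteq> X \<longrightarrow> X = M"
  proof (rule subset_Zorn_nonempty)
    fix \<C> assume C: "\<C> \<noteq> {}" "subset.chain ?F \<C>"
    then have sub: "\<C> \<subseteq> ?F" by (auto simp: subset.chain_def)
    have "\<epsilon> \<le> dist a b" if ab: "a \<in> \<Union>\<C>" "b \<in> \<Union>\<C>" "a \<noteq> b" for a b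
    proof -
      obtain Z where "Z \<in> \<C>" "{a, b} \<subseteq> Z"
        using finite_subset_Union_chain[of "{a, b}" \<C> ?F] C ab by blast
      then show ?thesis using sub ab by auto
    qed
    then show "\<Union>\<C> \<in> ?F" using sub by blast
  qed auto
  then obtain M where M: "M \<in> ?F" and max: "\<forall>X\<in>?F. M \<subseteq> X \<longrightarrow> X = M" by (rule bexE)
  have "\<exists>z\<in>M. dist y z < \<epsilon>" if "y \<in> U" for y
  proof (rule ccontr)
    assume *: "\<not> (\<exists>z\<in>M. dist y z < \<epsilon>)"
    then have "insert y M \<in> ?F" using M that by (auto simp: not_less dist_commute)
    then have "insert y M = M" by (rule max[rule_format]) auto
    then have "y \<in> M" by blast
    then show False using * assms by auto
  qed
  then show thesis using that[of M] M by blast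
qed

text \<open>The family is locally finite: two cells meeting one ball of radius \<epsilon>/8 would
  have centres at distance at most 2(\<epsilon>/4) + 2(\<epsilon>/8) < \<epsilon>.\<close>

lemma closed_Union_separated:
  fixes Z :: "'a::metric_space set"
  assumes "\<epsilon> > 0" "\<And>a b. a \<in> Z \<Longrightarrow> b \<in> Z \<Longrightarrow> a \<noteq> b \<Longrightarrow> \<epsilon> \<le> dist a b"
    and "\<And>z. z \<in> Z \<Longrightarrow> closed (C z)" "\<And>z. z \<in> Z \<Longrightarrow> C z \<subseteq> cball z (\<epsilon> / 4)"
  shows "closed (\<Union>z\<in>Z. C z)"
  unfolding closed_def open_subopen[of "- _"]
proof
  fix x assume x: "x \<in> - (\<Union>z\<in>Z. C z)"
  have near: "z = z'"
    if z: "z \<in> Z" "z' \<in> Z" "y \<in> C z" "y' \<in> C z'" "dist x y < \<epsilon> / 8" "dist x y' < \<epsilon> / 8" for z z' y y'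
  proof (rule ccontr)
    assume "z \<noteq> z'"
    then have "\<epsilon> \<le> dist z z'" using assms(2) z by blast
    moreover have "dist z y \<le> \<epsilon> / 4" "dist z' y' \<le> \<epsilon> / 4"
      using assms(4)[of z] assms(4)[of z'] z by auto
    moreover have "dist z z' \<le> dist z y + dist x y + dist x y' + dist z' y'"
      by (smt (verit) dist_commute dist_triangle)
    ultimately show False using z(5,6) assms(1) by linarith
  qed
  show "\<exists>V. open V \<and> x \<in> V \<and> V \<subseteq> - (\<Union>z\<in>Z. C z)"
  proof (cases "\<exists>z\<in>Z. \<exists>y\<in>C z. dist x y < \<epsilon> / 8")
    case True
    then obtain z y where z: "z \<in> Z" "y \<in> C z" "dist x y < \<epsilon> / 8" by blast
    have "ball x (\<epsilon> / 8) - C z \<subseteq> - (\<Union>z\<in>Z. C z)"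
      using near[OF z(1) _ z(2) _ z(3)] by auto
    moreover have "open (ball x (\<epsilon> / 8) - C z)" using assms(3) z(1) by (intro open_Diff) auto
    moreover have "x \<in> ball x (\<epsilon> / 8) - C z" using x z(1) assms(1) by auto
    ultimately show ?thesis by blast
  next
    case False
    then have "ball x (\<epsilon> / 8) \<subseteq> - (\<Union>z\<in>Z. C z)" by auto
    then show ?thesis using assms(1) by (intro exI[of _ "ball x (\<epsilon> / 8)"]) auto
  qed
qed

lemma dissection_step:
  fixes U :: "'a::{metric_space, perfect_space} set"
  assumes "open U" "\<epsilon> > 0"
  shows "\<exists>Z K I. Z \<subseteq> K \<and> K \<subseteq> U \<and> closed K \<and> open I \<and> I \<subseteq> K \<and> K - I \<subseteq> closure (U - K) \<and>
    (\<forall>y\<in>U. \<exists>z\<in>Z. dist y z < \<epsilon>) \<and> (if b then Z \<subseteq> I else I = {} \<and> K = Z)"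
proof -
  obtain Z where Z: "Z \<subseteq> U" "\<And>a b. a \<in> Z \<Longrightarrow> b \<in> Z \<Longrightarrow> a \<noteq> b \<Longrightarrow> \<epsilon> \<le> dist a b"
    "\<And>y. y \<in> U \<Longrightarrow> \<exists>z\<in>Z. dist y z < \<epsilon>"
    using maximal_separated_set[OF assms(2)] by blast
  have "\<exists>r>0. r \<le> \<epsilon> / 4 \<and> cball z r \<subseteq> U" if z: "z \<in> Z" for z
  proof -
    obtain e where "e > 0" "cball z e \<subseteq> U"
      using assms(1) Z(1) z unfolding open_contains_cball by (meson subsetD)
    moreover have "cball z (min e (\<epsilon> / 4)) \<subseteq> cball z e" by (rule subset_cball) simp
    ultimately show ?thesis using assms(2) by (intro exI[of _ "min e (\<epsilon> / 4)"]) auto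
  qed
  \<comment> \<open>The bound \<epsilon>/4 keeps cells with different centres disjoint and makes
    unions of cells closed.\<close>
  then obtain r where r: "\<And>z. z \<in> Z \<Longrightarrow> r z > 0" "\<And>z. z \<in> Z \<Longrightarrow> r z \<le> \<epsilon> / 4"
    "\<And>z. z \<in> Z \<Longrightarrow> cball z (r z) \<subseteq> U" by metis
  define C where "C z = (if b then cball z (r z) else {z})" for z
  have C: "closed (C z)" "C z \<subseteq> cball z (\<epsilon> / 4)" "z \<in> C z" "C z \<subseteq> U" if "z \<in> Z" for z
    using r[OF that] assms(2) Z(1) that by (auto simp: C_def)
  have disj: "z = z'" if "z \<in> Z" "z' \<in> Z" "x \<in> C z" "x \<in> C z'" for z z' x
  proof (rule ccontr)
    assume "z \<noteq> z'"
    then have "\<epsilon> \<le> dist z z'" using Z that by blast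
    moreover have "dist z x \<le> \<epsilon> / 4" "dist z' x \<le> \<epsilon> / 4"
      using C(2)[OF that(1)] C(2)[OF that(2)] that(3,4) by (auto simp: subset_eq)
    ultimately show False using dist_triangle2[of z z' x] assms(2) by linarith
  qed
  have cl: "closed (\<Union>z\<in>Z'. C z)" if "Z' \<subseteq> Z" for Z'
    by (rule closed_Union_separated[OF assms(2)]) (use that Z C in \<open>auto simp: subset_eq\<close>)
  \<comment> \<open>The interior of a closed ball may exceed the open ball. Taking the interior
    ensures that the remaining points of a cell are limits of the complement. Cells that are single
    points have empty interior because the space is dense in itself.\<close>
  let ?K = "\<Union>z\<in>Z. C z" and ?I = "\<Union>z\<in>Z. interior (C z)"
  have "x \<in> closure (U - ?K)" if x: "x \<in> ?K - ?I" for x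
    unfolding closure_iff_nhds_not_empty
  proof (intro allI impI)
    fix A V assume V: "V \<subseteq> A" "open V" "x \<in> V"
    obtain z where z: "z \<in> Z" "x \<in> C z" "x \<notin> interior (C z)" using x by blast
    \<comment> \<open>The other cells form a closed set avoiding \<open>x\<close>, so this is a
      neighbourhood of \<open>x\<close>. It is not contained in \<open>C z\<close>, as
      \<open>x\<close> is not interior to \<open>C z\<close>, and hence it contains points of
      \<open>U\<close> outside all cells.\<close>
    let ?V = "V \<inter> U - (\<Union>z\<in>Z - {z}. C z)"
    have "open ?V" using V assms cl[of "Z - {z}"] by (intro open_Diff) auto
    moreover have "x \<in> ?V" using V z C(4) disj by blast
    ultimately have "\<not> ?V \<subseteq> C z" using z(3) interior_maximal by blast
    then show "(U - ?K) \<inter> A \<noteq> {}" using V(1) by blast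
  qed
  then have front: "?K - ?I \<subseteq> closure (U - ?K)" by blast
  have cells: "if b then Z \<subseteq> ?I else ?I = {} \<and> ?K = Z"
  proof (cases b)
    case True
    have "z \<in> interior (C z)" if "z \<in> Z" for z
      using interior_maximal[OF ball_subset_cball open_ball, of z "r z"] r(1)[OF that] True
      by (auto simp: C_def subset_eq)
    then show ?thesis using True by auto
  qed (auto simp: C_def)
  have ZK: "Z \<subseteq> ?K" using C(3) by fast
  have KU: "?K \<subseteq> U" using C(4) by fast
  have I: "open ?I" "?I \<subseteq> ?K" using interior_subset by (blast, fast)
  have dense: "\<forall>y\<in>U. \<exists>z\<in>Z. dist y z < \<epsilon>" using Z(3) by fast
  show ?thesis
    by (rule exI[of _ Z], rule exI[of _ ?K], rule exI[of _ ?I]) (intro conjI ZK KU I front dense cl order.refl cells)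
qed

text \<open>
  At stage \<open>n\<close> a maximal \<open>1/(n+1)\<close>-separated set \<open>Z n\<close> is chosen in the part of \<open>G\<close> not yet used, and
  disjoint small closed balls around its points (if \<open>b n\<close>) or just these points are used up; \<open>K n\<close>
  is what is used up and \<open>I n\<close> consists of the interiors of the balls.
\<close>

lemma dissection:
  fixes G :: "'a::{metric_space, perfect_space} set"
  assumes "open G"
  obtains Z K I :: "nat \<Rightarrow> 'a set" where
    "\<And>n. Z n \<subseteq> K n" "\<And>n. K n \<subseteq> G" "\<And>n. I n \<subseteq> K n" "\<And>n. open (I n)"
    "\<And>n. b n \<Longrightarrow> Z n \<subseteq> I n" "\<And>n. \<not> b n \<Longrightarrow> I n = {} \<and> K n = Z n"
    "\<And>m n x. x \<in> K m \<Longrightarrow> x \<in> K n \<Longrightarrow> m = n"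
    "\<And>x J. x \<in> closure G \<Longrightarrow> (\<And>n. x \<notin> I n) \<Longrightarrow> infinite J \<Longrightarrow> x \<in> closure (\<Union>n\<in>J. Z n)"
    "G \<noteq> {} \<Longrightarrow> Z 0 \<noteq> {}"
proof -
  define Q where "Q b \<epsilon> U Z K I \<longleftrightarrow>
    Z \<subseteq> K \<and> K \<subseteq> U \<and> closed K \<and> open I \<and> I \<subseteq> K \<and> K - I \<subseteq> closure (U - K) \<and>
    (\<forall>y\<in>U. \<exists>z\<in>Z. dist y z < \<epsilon>) \<and> (if b then Z \<subseteq> I else I = {} \<and> K = Z)"
    for b and \<epsilon> :: real and U Z K I :: "'a set"
  have "\<exists>Z K I. Q b \<epsilon> U Z K I" if "open U" "\<epsilon> > 0" for b \<epsilon> U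
    using dissection_step[OF that] unfolding Q_def .
  then have "\<forall>b \<epsilon> U. \<exists>S. open U \<and> \<epsilon> > 0 \<longrightarrow> Q b \<epsilon> U (fst S) (fst (snd S)) (snd (snd S))"
    by (metis fst_conv snd_conv)
  then obtain fS where fS:
    "\<forall>b \<epsilon> U. open U \<and> \<epsilon> > 0 \<longrightarrow> Q b \<epsilon> U (fst (fS b \<epsilon> U)) (fst (snd (fS b \<epsilon> U))) (snd (snd (fS b \<epsilon> U)))"
    by metis
  define fZ where "fZ b \<epsilon> U = fst (fS b \<epsilon> U)" for b \<epsilon> U
  define fK where "fK b \<epsilon> U = fst (snd (fS b \<epsilon> U))" for b \<epsilon> U
  define fI where "fI b \<epsilon> U = snd (snd (fS b \<epsilon> U))" for b \<epsilon> U
  have "Q b \<epsilon> U (fZ b \<epsilon> U) (fK b \<epsilon> U) (fI b \<epsilon> U)" if "open U" "\<epsilon> > 0" for b \<epsilon> U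
    unfolding fZ_def fK_def fI_def using fS that by blast
  note step = this[unfolded Q_def]
  define \<epsilon> :: "nat \<Rightarrow> real" where "\<epsilon> n = 1 / Suc n" for n
  define U where "U = rec_nat G (\<lambda>n U. U - fK (b n) (\<epsilon> n) U)"
  define Z where "Z n = fZ (b n) (\<epsilon> n) (U n)" for n
  define K where "K n = fK (b n) (\<epsilon> n) (U n)" for n
  define I where "I n = fI (b n) (\<epsilon> n) (U n)" for n
  have U_0: "U 0 = G" and U_Suc: "U (Suc n) = U n - K n" for n by (auto simp: U_def K_def)
  have \<epsilon>: "\<epsilon> n > 0" for n by (simp add: \<epsilon>_def)
  have open_U: "open (U n)" for n
  proof (induction n)
    case (Suc n)
    then show ?case using step[OF Suc \<epsilon>] by (auto simp: U_Suc K_def)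
  qed (simp add: U_0 assms)
  note ZKI = step[OF open_U \<epsilon>, of "b n" n n for n, folded Z_def K_def I_def]
  have U_mono: "U n \<subseteq> U m" if "m \<le> n" for m n
    by (rule lift_Suc_antimono_le[of U, OF _ that]) (auto simp: U_Suc)
  have "K m \<inter> K n = {}" if "m < n" for m n
    using U_mono[of "Suc m" n] ZKI[of n] that by (auto simp: U_Suc)
  then have disj: "m = n" if "x \<in> K m" "x \<in> K n" for x m n
    using that by (metis disjoint_iff linorder_neqE_nat)
  \<comment> \<open>Removing \<open>K n\<close> does not detach \<open>x\<close> from what is left:
    on \<open>K n\<close> outside \<open>I n\<close> this is the frontier property of the step, and
    elsewhere \<open>K n\<close> is closed and misses a neighbourhood of \<open>x\<close>.\<close>
  have acc: "x \<in> closure (U n)" if x: "x \<in> closure G" "\<And>n. x \<notin> I n" for x n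
  proof (induction n)
    case (Suc n)
    show ?case
    proof (cases "x \<in> K n")
      case True
      then show ?thesis using ZKI[of n] x(2) by (auto simp: U_Suc)
    next
      case False
      then have "x \<in> closure (- K n \<inter> U n)"
        using open_Int_closure_subset[of "- K n" "U n"] ZKI[of n] Suc by auto
      then show ?thesis by (simp add: U_Suc Diff_eq Int_commute)
    qed
  qed (simp add: U_0 x)
  have dense: "x \<in> closure (\<Union>n\<in>J. Z n)" if x: "x \<in> closure G" "\<And>n. x \<notin> I n" and J: "infinite J" for x J
    unfolding closure_approachable
  proof (intro allI impI)
    fix e :: real assume "e > 0"
    then obtain m where m: "inverse (Suc m) < e / 2" using reals_Archimedean[of "e / 2"] by auto
    obtain n where n: "n \<in> J" "m \<le> n" using J infinite_nat_iff_unbounded_le by blast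
    have "\<epsilon> n \<le> inverse (Suc m)" using n by (simp add: \<epsilon>_def field_simps)
    obtain y where y: "y \<in> U n" "dist y x < e / 2"
      using acc[OF x, of n] \<open>e > 0\<close> unfolding closure_approachable by (meson half_gt_zero)
    obtain z where z: "z \<in> Z n" "dist y z < \<epsilon> n" using ZKI[of n] y by blast
    have "dist z x < e"
      using dist_triangle[of z x y] y z m \<open>\<epsilon> n \<le> _\<close> by (simp add: dist_commute)
    then show "\<exists>y\<in>\<Union>n\<in>J. Z n. dist y x < e" using z n by blast
  qed
  show thesis
  proof (rule that[of Z K I])
    fix n
    show "Z n \<subseteq> K n" "I n \<subseteq> K n" "open (I n)" using ZKI[of n] by auto
    show "K n \<subseteq> G" using ZKI[of n] U_mono[of 0 n] U_0 by blast
    show "Z n \<subseteq> I n" if "b n" using ZKI[of n] that by simp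
    show "I n = {} \<and> K n = Z n" if "\<not> b n" using ZKI[of n] that by simp
    show "Z 0 \<noteq> {}" if "G \<noteq> {}" using that ZKI[of 0] U_0 by blast
  qed (fact disj, fact dense)
qed

lemma infinitely_repeating_enumeration:
  assumes "countable A" "a \<in> A"
  obtains e :: "nat \<Rightarrow> 'b" where "e 0 = a" "\<And>n. e n \<in> A" "\<And>v. v \<in> A \<Longrightarrow> infinite {n. e n = v}"
proof -
  \<comment> \<open>The second coordinate of the decoded pair is ignored, which makes every value
    recur infinitely often. Overwriting index 0 costs at most one occurrence.\<close>
  define e where "e n = (if n = 0 then a else from_nat_into A (fst (prod_decode n)))" for n
  have "infinite {n. e n = v}" if v: "v \<in> A" for v
  proof -
    obtain k where k: "from_nat_into A k = v" using assms v by (metis from_nat_into_surj)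
    let ?S = "range (\<lambda>m. prod_encode (k, m))"
    have "infinite ?S" by (intro range_inj_infinite injI) (simp add: prod_encode_eq)
    then have "infinite (?S - {0})" by simp
    moreover have "?S - {0} \<subseteq> {n. e n = v}" using k by (auto simp: e_def)
    ultimately show ?thesis using finite_subset by blast
  qed
  moreover have "e n \<in> A" for n using assms from_nat_into[of A] by (auto simp: e_def)
  ultimately show thesis using that[of e] by (simp add: e_def)
qed

subsection \<open>Interior maps onto finite connected frames\<close>

locale finite_frame =
  fixes W :: "'w set" and R :: "'w \<Rightarrow> 'w \<Rightarrow> bool"
  assumes finite_W: "finite W"
    and R_refl: "w \<in> W \<Longrightarrow> R w w"
    and R_trans: "u \<in> W \<Longrightarrow> v \<in> W \<Longrightarrow> w \<in> W \<Longrightarrow> R u v \<Longrightarrow> R v w \<Longrightarrow> R u w"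
begin

text \<open>A map from \<open>G\<close> into the cone of \<open>w\<close> that is continuous and
  open for the topology of upward closed sets. The clause about the frontier allows gluing: a
  frontier point sent to \<open>w\<close> is a limit of every fibre it must see.\<close>

definition full_rep :: "'a::topological_space set \<Rightarrow> 'w \<Rightarrow> ('a \<Rightarrow> 'w) \<Rightarrow> bool" where
  "full_rep G w \<rho> \<longleftrightarrow>
    (\<forall>x\<in>G. \<rho> x \<in> W \<and> R w (\<rho> x)) \<and>
    (\<forall>x\<in>G. \<exists>N. open N \<and> x \<in> N \<and> (\<forall>y\<in>N \<inter> G. R (\<rho> x) (\<rho> y))) \<and>
    (\<forall>x\<in>G. \<forall>v\<in>W. R (\<rho> x) v \<longrightarrow> x \<in> closure {y\<in>G. \<rho> y = v}) \<and>
    (\<forall>x\<in>closure G - G. \<forall>v\<in>W. R w v \<longrightarrow> x \<in> closure {y\<in>G. \<rho> y = v}) \<and>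
    (G \<noteq> {} \<longrightarrow> (\<exists>x\<in>G. \<rho> x = w))"

lemma full_repD:
  assumes "full_rep G w \<rho>"
  shows "x \<in> G \<Longrightarrow> \<rho> x \<in> W" "x \<in> G \<Longrightarrow> R w (\<rho> x)"
    "x \<in> G \<Longrightarrow> \<exists>N. open N \<and> x \<in> N \<and> (\<forall>y\<in>N \<inter> G. R (\<rho> x) (\<rho> y))"
    "x \<in> G \<Longrightarrow> v \<in> W \<Longrightarrow> R (\<rho> x) v \<Longrightarrow> x \<in> closure {y\<in>G. \<rho> y = v}"
    "x \<in> closure G \<Longrightarrow> x \<notin> G \<Longrightarrow> v \<in> W \<Longrightarrow> R w v \<Longrightarrow> x \<in> closure {y\<in>G. \<rho> y = v}"
    "G \<noteq> {} \<Longrightarrow> \<exists>x\<in>G. \<rho> x = w"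
  using assms unfolding full_rep_def by blast+

text \<open>Induction on the size of the cone. Points in the cluster of \<open>w\<close> are
  realised by scattered single points, and each value strictly above \<open>w\<close> by small balls
  on which the induction hypothesis supplies the map.\<close>

lemma full_rep_exists:
  fixes G :: "'a::{metric_space, perfect_space} set"
  assumes "w \<in> W" "open G"
  shows "\<exists>\<rho>. full_rep G w \<rho>"
  using assms
proof (induction "card {v\<in>W. R w v}" arbitrary: w G rule: less_induct)
  case less
  note w = \<open>w \<in> W\<close>
  let ?cone = "\<lambda>w. {v\<in>W. R w v}"
  obtain lab where lab: "lab (0::nat) = w" "\<And>n. lab n \<in> ?cone w"
    "\<And>v. v \<in> ?cone w \<Longrightarrow> infinite {n. lab n = v}"
    using infinitely_repeating_enumeration[of "?cone w" w] w R_refl finite_W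
    by (auto simp: countable_finite)
  define b where "b n \<longleftrightarrow> \<not> R (lab n) w" for n
  obtain Z K I :: "nat \<Rightarrow> 'a set" where
    ZKI: "\<And>n. Z n \<subseteq> K n" "\<And>n. K n \<subseteq> G" "\<And>n. I n \<subseteq> K n" "\<And>n. open (I n)"
    and b: "\<And>n. b n \<Longrightarrow> Z n \<subseteq> I n" and nb: "\<And>n. \<not> b n \<Longrightarrow> I n = {} \<and> K n = Z n"
    and disj: "\<And>m n x. x \<in> K m \<Longrightarrow> x \<in> K n \<Longrightarrow> m = n"
    and acc: "\<And>x J. x \<in> closure G \<Longrightarrow> (\<And>n. x \<notin> I n) \<Longrightarrow> infinite J \<Longrightarrow> x \<in> closure (\<Union>n\<in>J. Z n)"
    and Z0: "G \<noteq> {} \<Longrightarrow> Z 0 \<noteq> {}"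
    using dissection[OF less.prems(2), where b = b] by blast
  \<comment> \<open>All balls with one label are represented together: a point may be a limit of
    infinitely many of them without touching any, and only the frontier clause for their union
    applies to it.\<close>
  define H where "H v = (\<Union>n\<in>{n. lab n = v}. I n)" for v
  have H: "open (H v)" "H v \<subseteq> G" for v using ZKI unfolding H_def by blast+
  have "\<exists>\<rho>. full_rep (H v) v \<rho>" if v: "v \<in> W" "R w v" "\<not> R v w" for v
  proof (rule less.hyps)
    have "?cone v \<subset> ?cone w" using v w R_trans R_refl by blast
    then show "card (?cone v) < card (?cone w)" using finite_W by (simp add: psubset_card_mono)
  qed (use v H in auto)
  then obtain r where r: "\<And>v. v \<in> W \<Longrightarrow> R w v \<Longrightarrow> \<not> R v w \<Longrightarrow> full_rep (H v) v (r v)" by metis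
  \<comment> \<open>Leftover points, among them the frontiers of the balls, receive the default
    \<open>w\<close>. Disjointness of the sets \<open>K n\<close> makes the index unique.\<close>
  define \<rho> where "\<rho> x = (if \<exists>n. x \<in> I n then r (lab (THE n. x \<in> K n)) x
    else if \<exists>n. x \<in> K n \<and> \<not> b n then lab (THE n. x \<in> K n) else w)" for x
  have the: "(THE n. x \<in> K n) = n" if "x \<in> K n" for x n using disj that by blast
  have \<rho>_H: "\<rho> x = r v x" if "x \<in> H v" for x v
    using that the ZKI(3) unfolding H_def \<rho>_def by fastforce
  have \<rho>_Z: "\<rho> x = lab n" if "x \<in> Z n" "\<not> b n" for x n
  proof -
    have x: "x \<in> K n" using that ZKI by blast
    then have "x \<notin> I m" for m using disj[OF x, of m] nb[OF that(2)] ZKI(3)[of m] by blast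
    then show ?thesis using x the that by (auto simp: \<rho>_def)
  qed
  have \<rho>_B: "\<rho> x \<in> W \<and> R w (\<rho> x) \<and> R (\<rho> x) w" if "\<And>n. x \<notin> I n" for x
    using that lab(2) w R_refl the by (auto simp: \<rho>_def b_def)
  have strict: "v \<in> W" "R w v" "\<not> R v w" if "x \<in> H v" for x v
    using that lab(2) nb by (auto simp: H_def b_def)
  \<comment> \<open>If \<open>v\<close> is in the cluster of \<open>w\<close>, the centres labelled
    \<open>v\<close> take that value and accumulate at \<open>x\<close>. Otherwise the balls
    labelled \<open>v\<close> accumulate at \<open>x\<close>, which lies outside them, and the
    frontier clause for \<open>H v\<close> gives the claim.\<close>
  have key: "x \<in> closure {y\<in>G. \<rho> y = v}"
    if x: "x \<in> closure G" "\<And>n. x \<notin> I n" and v: "v \<in> W" "R w v" for x v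
  proof -
    have Zv: "x \<in> closure (\<Union>n\<in>{n. lab n = v}. Z n)" using acc[OF x] lab(3) v by simp
    show ?thesis
    proof (cases "R v w")
      case True
      have "(\<Union>n\<in>{n. lab n = v}. Z n) \<subseteq> {y\<in>G. \<rho> y = v}"
        using ZKI(1,2) \<rho>_Z True by (fastforce simp: b_def)
      then show ?thesis using Zv closure_mono by blast
    next
      case False
      have "(\<Union>n\<in>{n. lab n = v}. Z n) \<subseteq> H v" using b False by (fastforce simp: b_def H_def)
      then have "x \<in> closure (H v)" using Zv closure_mono by blast
      moreover have "x \<notin> H v" using x(2) by (auto simp: H_def)
      ultimately have "x \<in> closure {y\<in>H v. r v y = v}"
        using full_repD(5)[OF r[OF v False]] v R_refl by blast
      moreover have "{y\<in>H v. r v y = v} \<subseteq> {y\<in>G. \<rho> y = v}" using \<rho>_H H(2)[of v] by auto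
      ultimately show ?thesis using closure_mono by blast
    qed
  qed
  have cases: thesis if "\<And>v. x \<in> H v \<Longrightarrow> thesis" "(\<And>n. x \<notin> I n) \<Longrightarrow> thesis" for x thesis
    using that by (auto simp: H_def)
  have cone: "\<rho> x \<in> W \<and> R w (\<rho> x)" for x
  proof (rule cases[of x])
    fix v assume v: "x \<in> H v"
    note f = r[OF strict[OF v]]
    show ?thesis using \<rho>_H[OF v] full_repD(1,2)[OF f v] R_trans[OF w _ _ strict(2)[OF v]] strict(1)[OF v] by auto
  qed (use \<rho>_B in blast)
  have "full_rep G w \<rho>"
    unfolding full_rep_def
  proof (intro conjI ballI impI)
    fix x assume x: "x \<in> G"
    show "\<exists>N. open N \<and> x \<in> N \<and> (\<forall>y\<in>N \<inter> G. R (\<rho> x) (\<rho> y))"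
    proof (rule cases[of x])
      fix v assume v: "x \<in> H v"
      obtain N where "open N" "x \<in> N" "\<forall>y\<in>N \<inter> H v. R (r v x) (r v y)"
        using full_repD(3)[OF r[OF strict[OF v]] v] by blast
      then show ?thesis using v H \<rho>_H by (intro exI[of _ "N \<inter> H v"]) auto
    next
      \<comment> \<open>Outside the balls the value lies in the cluster of \<open>w\<close>, from
        which the whole cone is visible, so any neighbourhood will do.\<close>
      assume "\<And>n. x \<notin> I n"
      then have "R (\<rho> x) (\<rho> y)" for y
        using \<rho>_B[of x] cone[of y] R_trans[of "\<rho> x" w "\<rho> y"] w by blast
      then show ?thesis by (intro exI[of _ UNIV]) auto
    qed
    show "x \<in> closure {y\<in>G. \<rho> y = v}" if v: "v \<in> W" "R (\<rho> x) v" for v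
    proof (rule cases[of x])
      fix u assume u: "x \<in> H u"
      have "x \<in> closure {y\<in>H u. r u y = v}"
        using full_repD(4)[OF r[OF strict[OF u]] u] v \<rho>_H[OF u] by simp
      moreover have "{y\<in>H u. r u y = v} \<subseteq> {y\<in>G. \<rho> y = v}" using \<rho>_H H(2)[of u] by auto
      ultimately show ?thesis using closure_mono by blast
    next
      assume nI: "\<And>n. x \<notin> I n"
      have "R w v" using R_trans[OF w _ v(1) _ v(2)] cone by blast
      then show ?thesis using key[OF _ nI v(1)] x closure_subset by blast
    qed
  next
    assume "G \<noteq> {}"
    then obtain z where "z \<in> Z 0" using Z0 by blast
    then show "\<exists>x\<in>G. \<rho> x = w" using \<rho>_Z[of z 0] lab(1) ZKI w R_refl by (fastforce simp: b_def)
  qed (use cone key ZKI in blast)+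
  then show ?case by blast
qed

text \<open>Continuity and openness for the topology of upward closed sets on \<open>W\<close>,
  written out in terms of \<open>R\<close>.\<close>

definition interior_map :: "('a::topological_space \<Rightarrow> 'w) \<Rightarrow> bool" where
  "interior_map f \<longleftrightarrow> (\<forall>x. f x \<in> W) \<and>
    (\<forall>x. \<exists>N. open N \<and> x \<in> N \<and> (\<forall>y\<in>N. R (f x) (f y))) \<and>
    (\<forall>x. \<forall>v\<in>W. R (f x) v \<longrightarrow> x \<in> closure {y. f y = v})"

lemma interior_mapD:
  assumes "interior_map f"
  shows "f x \<in> W" "\<exists>N. open N \<and> x \<in> N \<and> (\<forall>y\<in>N. R (f x) (f y))"
    "v \<in> W \<Longrightarrow> R (f x) v \<Longrightarrow> x \<in> closure {y. f y = v}"
  using assms unfolding interior_map_def by blast+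

lemma interior_map_extend_range:
  fixes f :: "'a::{metric_space, perfect_space} \<Rightarrow> 'w"
  assumes f: "interior_map f" and u: "u \<in> W" "R u (f x0)"
  obtains g :: "'a \<Rightarrow> 'w" where "interior_map g" "range f \<subseteq> range g" "u \<in> range g"
proof -
  obtain N where N: "open N" "x0 \<in> N" "\<And>y. y \<in> N \<Longrightarrow> R (f x0) (f y)" using interior_mapD(2)[OF f, of x0] by auto
  \<comment> \<open>One preimage is reserved for each value of \<open>f\<close>. The ball avoids
    these finitely many points, which is possible because nonempty open sets are infinite, and so no
    value is lost.\<close>
  define p where "p = inv f"
  have p: "f (p v) = v" if "v \<in> range f" for v using that by (simp add: p_def f_inv_into_f)
  have "finite (range f)" using finite_W interior_mapD(1)[OF f] finite_subset[of "range f" W] by blast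
  then have fin: "finite (p ` range f)" by simp
  have "openin (top_of_set UNIV) N" using N(1) by (auto simp: openin_open)
  then have "infinite N" by (rule infinite_openin) (use N(2) islimpt_UNIV in auto)
  then have "infinite (N - p ` range f)" by (rule Diff_infinite_finite[OF fin])
  then have "N - p ` range f \<noteq> {}" by (metis finite.emptyI)
  moreover have "open (N - p ` range f)" using N fin by (intro open_Diff finite_imp_closed)
  ultimately obtain c \<delta> where \<delta>: "\<delta> > 0" "cball c \<delta> \<subseteq> N - p ` range f"
    by (metis open_contains_cball ex_in_conv)
  let ?G = "ball c \<delta>"
  have cl: "closure ?G \<subseteq> N - p ` range f" using \<delta> closure_minimal[of ?G "cball c \<delta>"] by auto
  obtain \<rho> where \<rho>: "full_rep ?G u \<rho>" using full_rep_exists[OF u(1), of ?G] by auto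
  \<comment> \<open>The frontier is taken relative to \<open>closure ?G\<close>, not
    \<open>cball c \<delta>\<close>: a point at distance \<open>\<delta>\<close> from the centre
    need not be a limit of the ball, and then it must keep its value.\<close>
  define g where "g x = (if x \<in> ?G then \<rho> x else if x \<in> closure ?G then u else f x)" for x
  have fW: "f x \<in> W" for x using interior_mapD(1)[OF f] .
  have gG: "g x = \<rho> x" if "x \<in> ?G" for x using that by (simp add: g_def)
  have gu: "g x = u" if "x \<in> closure ?G" "x \<notin> ?G" for x using that by (simp add: g_def)
  have gf: "g x = f x" if "x \<notin> closure ?G" for x using that closure_subset[of ?G] by (auto simp: g_def)
  have G_sub: "{y\<in>?G. \<rho> y = v} \<subseteq> {y. g y = v}" for v using gG by auto
  have "interior_map g"
    unfolding interior_map_def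
  proof (intro conjI allI ballI impI)
    fix x
    show "g x \<in> W" using full_repD(1)[OF \<rho>] u fW by (simp add: g_def)
    consider "x \<in> ?G" | "x \<in> closure ?G" "x \<notin> ?G" | "x \<notin> closure ?G" by blast
    note cases = this
    show "\<exists>N. open N \<and> x \<in> N \<and> (\<forall>y\<in>N. R (g x) (g y))"
    proof (rule cases)
      assume x: "x \<in> ?G"
      obtain M where "open M" "x \<in> M" "\<forall>y\<in>M \<inter> ?G. R (\<rho> x) (\<rho> y)" using full_repD(3)[OF \<rho> x] by blast
      then show ?thesis using x gG by (intro exI[of _ "M \<inter> ?G"]) auto
    next
      assume x: "x \<in> closure ?G" "x \<notin> ?G"
      \<comment> \<open>Near the frontier every value is seen from \<open>u\<close>: inside the ball
        by the choice of \<open>\<rho>\<close>, and outside because \<open>u\<close> sees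
        \<open>f x0\<close>, which sees all values of \<open>f\<close> on \<open>N\<close>.\<close>
      have "R u (g y)" if "y \<in> N" for y
        using full_repD(2)[OF \<rho>] R_refl[OF u(1)] R_trans[OF u(1) fW fW u(2) N(3)[OF that]]
        by (simp add: g_def)
      then show ?thesis using x gu N(1) cl by (intro exI[of _ N]) auto
    next
      assume x: "x \<notin> closure ?G"
      obtain M where "open M" "x \<in> M" "\<forall>y\<in>M. R (f x) (f y)" using interior_mapD(2)[OF f, of x] by auto
      then show ?thesis using x gf by (intro exI[of _ "M - closure ?G"]) auto
    qed
    show "x \<in> closure {y. g y = v}" if v: "v \<in> W" "R (g x) v" for v
    proof (rule cases)
      assume "x \<in> ?G"
      then show ?thesis using full_repD(4)[OF \<rho>, of x v] v gG closure_mono[OF G_sub] by auto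
    next
      assume "x \<in> closure ?G" "x \<notin> ?G"
      then show ?thesis using full_repD(5)[OF \<rho>, of x v] v gu closure_mono[OF G_sub] by auto
    next
      assume x: "x \<notin> closure ?G"
      then have "x \<in> closure {y. f y = v}" using interior_mapD(3)[OF f v(1)] v(2) gf by auto
      then have "x \<in> closure (- closure ?G \<inter> {y. f y = v})"
        using open_Int_closure_subset[of "- closure ?G" "{y. f y = v}"] x by blast
      moreover have "- closure ?G \<inter> {y. f y = v} \<subseteq> {y. g y = v}" using gf by auto
      ultimately show ?thesis using closure_mono by blast
    qed
  qed
  moreover have "v \<in> range g" if "v \<in> range f" for v
  proof -
    have "p v \<notin> closure ?G" using cl that by blast
    then show ?thesis using gf p[OF that] by (metis rangeI)
  qed
  moreover have "u \<in> range g"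
    using full_repD(6)[OF \<rho>] \<delta>(1) gG by (metis ball_eq_empty not_le rangeI)
  ultimately show thesis using that by blast
qed

text \<open>A map with range of largest size has a range closed upwards by openness and downwards by
  \<open>interior_map_extend_range\<close>.\<close>

theorem interior_map_onto:
  assumes "W \<noteq> {}"
    and conn: "\<And>A. A \<subseteq> W \<Longrightarrow> A \<noteq> {} \<Longrightarrow>
      (\<And>u v. u \<in> W \<Longrightarrow> v \<in> W \<Longrightarrow> R u v \<Longrightarrow> u \<in> A \<longleftrightarrow> v \<in> A) \<Longrightarrow> A = W"
  obtains f :: "'a::{metric_space, perfect_space} \<Rightarrow> 'w" where "interior_map f" "range f = W"
proof -
  obtain w where w: "w \<in> W" using assms(1) by blast
  obtain \<rho> where "full_rep (UNIV :: 'a set) w \<rho>" using full_rep_exists[OF w] by blast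
  then have "interior_map \<rho>" by (auto simp: full_rep_def interior_map_def)
  moreover have sub: "range f \<subseteq> W" if "interior_map f" for f :: "'a \<Rightarrow> 'w"
    using interior_mapD(1)[OF that] by blast
  then have "\<forall>f :: 'a \<Rightarrow> 'w. interior_map f \<longrightarrow> card (range f) < Suc (card W)"
    using finite_W card_mono by (metis less_Suc_eq_le)
  ultimately obtain f :: "'a \<Rightarrow> 'w" where f: "interior_map f"
    and max: "\<And>g :: 'a \<Rightarrow> 'w. interior_map g \<Longrightarrow> card (range g) \<le> card (range f)"
    using ex_has_greatest_nat[of interior_map \<rho> "\<lambda>f. card (range f)" "Suc (card W)"] by auto
  have "range f = W"
  proof (rule conn)
    fix u v assume uv: "u \<in> W" "v \<in> W" "R u v"
    show "u \<in> range f \<longleftrightarrow> v \<in> range f"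
    proof
      assume "u \<in> range f"
      then obtain x where "x \<in> closure {y. f y = v}" using interior_mapD(3)[OF f uv(2)] uv(3) by blast
      then have "{y. f y = v} \<noteq> {}" by (metis closure_empty empty_iff)
      then show "v \<in> range f" by blast
    next
      assume "v \<in> range f"
      then obtain x where x: "v = f x" by blast
      obtain g :: "'a \<Rightarrow> 'w" where g: "interior_map g" "range f \<subseteq> range g" "u \<in> range g"
        using interior_map_extend_range[OF f uv(1)] uv(3) x by blast
      have "range g = range f"
        using card_seteq[OF _ g(2) max[OF g(1)]] finite_subset[OF sub[OF g(1)] finite_W] by simp
      then show "u \<in> range f" using g(3) by simp
    qed
  qed (use sub[OF f] in auto)
  then show thesis using that f by blast
qed

end

subsection \<open>Completeness\<close>

context filtration
begin

sublocale frame: finite_frame nodes node_le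
  by unfold_locales (use finite_nodes node_le_refl node_le_trans in blast)+

text \<open>Continuity and openness match the neighbourhoods of \<open>x\<close> with the nodes
  above \<open>f x\<close>, and surjectivity is what \<open>Univ\<close> requires. The tangle needs
  finiteness as well: a topological witness set must be brought down to a single cluster.\<close>

lemma holds_iff_node:
  fixes f :: "'a::topological_space \<Rightarrow> 'v node"
  assumes f: "frame.interior_map f" and onto: "range f = nodes"
    and h: "\<And>p. h p = {x. Atom p \<in> fst (f x)}"
  shows "\<phi> \<in> \<Sigma> \<Longrightarrow> holds h x \<phi> \<longleftrightarrow> \<phi> \<in> fst (f x)"
proof (induction \<phi> arbitrary: x)
  case (Atom p)
  then show ?case by (simp add: h)
next
  case Top
  obtain y where "y \<in> P" "fst (f x) = tp y" using node_point[OF frame.interior_mapD(1)[OF f]] by metis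
  then show ?case using Top mcs_Conj[OF P_mcs, of y "[]"] by (simp add: tp_def Conj_def)
next
  case (Neg \<phi>)
  obtain y where "y \<in> P" "fst (f x) = tp y" using node_point[OF frame.interior_mapD(1)[OF f]] by metis
  moreover have "\<phi> \<in> \<Sigma>" using subf_closed Neg.prems by blast
  ultimately show ?case using Neg mcs_Neg[OF P_mcs, of y \<phi>] \<Sigma>_L by (auto simp: tp_def)
next
  case (And \<phi> \<psi>)
  obtain y where "y \<in> P" "fst (f x) = tp y" using node_point[OF frame.interior_mapD(1)[OF f]] by metis
  moreover have "\<phi> \<in> \<Sigma>" "\<psi> \<in> \<Sigma>" using subf_closed And.prems by blast+
  ultimately show ?case using And mcs_And[OF P_mcs, of y \<phi> \<psi>] by (simp add: tp_def)
next
  case (Box \<phi>)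
  have "\<phi> \<in> \<Sigma>" using subf_closed Box.prems by blast
  then have IH: "{y. holds h y \<phi>} = {y. \<phi> \<in> fst (f y)}" using Box.IH by simp
  have "x \<in> interior {y. \<phi> \<in> fst (f y)} \<longleftrightarrow> (\<forall>m\<in>nodes. node_le (f x) m \<longrightarrow> \<phi> \<in> fst m)"
  proof (intro iffI ballI impI)
    fix m assume x: "x \<in> interior {y. \<phi> \<in> fst (f y)}" and m: "m \<in> nodes" "node_le (f x) m"
    have "x \<in> closure {y. f y = m}" using frame.interior_mapD(3)[OF f m] .
    then have "interior {y. \<phi> \<in> fst (f y)} \<inter> {y. f y = m} \<noteq> {}"
      using x open_Int_closure_eq_empty[OF open_interior] by blast
    then show "\<phi> \<in> fst m" using interior_subset by fastforce
  next
    assume *: "\<forall>m\<in>nodes. node_le (f x) m \<longrightarrow> \<phi> \<in> fst m"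
    obtain N where N: "open N" "x \<in> N" "\<forall>y\<in>N. node_le (f x) (f y)"
      using frame.interior_mapD(2)[OF f, of x] by auto
    have "N \<subseteq> {y. \<phi> \<in> fst (f y)}" using N(3) * frame.interior_mapD(1)[OF f] by blast
    then show "x \<in> interior {y. \<phi> \<in> fst (f y)}" using N(1,2) interiorI by metis
  qed
  then show ?case
    unfolding holds_Box IH using node_Box[OF frame.interior_mapD(1)[OF f] Box.prems] by simp
next
  case (Univ \<phi>)
  have "\<phi> \<in> \<Sigma>" using subf_closed Univ.prems by blast
  then have "holds h x (Univ \<phi>) \<longleftrightarrow> (\<forall>m\<in>range f. \<phi> \<in> fst m)" using Univ.IH by simp
  then show ?case
    unfolding onto using node_Univ[OF frame.interior_mapD(1)[OF f] Univ.prems] by simp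
next
  case (Tangle \<Gamma>)
  have IH: "holds h y \<gamma> \<longleftrightarrow> \<gamma> \<in> fst (f y)" if "\<gamma> |\<in>| \<Gamma>" for y \<gamma>
    using Tangle.IH[OF that] subf_closed(5)[OF Tangle.prems that] by simp
  note fW = frame.interior_mapD(1)[OF f]
  have "holds h x (Tangle \<Gamma>) \<longleftrightarrow> (\<exists>m\<in>nodes. node_le (f x) m \<and>
    (\<forall>\<gamma>. \<gamma> |\<in>| \<Gamma> \<longrightarrow> (\<exists>k\<in>nodes. node_le m k \<and> node_le k m \<and> \<gamma> \<in> fst k)))"
    (is "_ \<longleftrightarrow> ?rhs")
  proof
    assume "holds h x (Tangle \<Gamma>)"
    then obtain S where S: "x \<in> S" "\<And>y \<gamma>. y \<in> S \<Longrightarrow> \<gamma> |\<in>| \<Gamma> \<Longrightarrow> y \<in> closure ({y. holds h y \<gamma>} \<inter> S)"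
      unfolding holds_Tangle by blast
    \<comment> \<open>At a point of \<open>S\<close> with the fewest nodes above its value, all
      nearby points of \<open>S\<close> take values in the same cluster. Density of each
      \<open>\<gamma>\<close> in \<open>S\<close> then realises \<open>\<gamma>\<close> in that
      cluster.\<close>
    let ?up = "\<lambda>y. {m\<in>nodes. node_le (f y) m}"
    let ?Q = "\<lambda>y. y \<in> S \<and> node_le (f x) (f y)"
    obtain y where y: "?Q y" and min: "\<And>z. ?Q z \<Longrightarrow> card (?up y) \<le> card (?up z)"
      using ex_has_least_nat[of ?Q x "\<lambda>y. card (?up y)"] S(1) node_le_refl by blast
    have max: "node_le (f z) (f y)" if z: "z \<in> S" "node_le (f y) (f z)" for z
    proof -
      have "?up z = ?up y"
      proof (rule card_seteq)
        show "finite (?up y)" using finite_nodes by simp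
        show "?up z \<subseteq> ?up y" using node_le_trans[OF z(2)] by auto
        show "card (?up y) \<le> card (?up z)" by (rule min) (use z y node_le_trans in blast)
      qed
      moreover have "f y \<in> ?up y" using fW node_le_refl by simp
      ultimately show ?thesis by blast
    qed
    have "\<exists>k\<in>nodes. node_le (f y) k \<and> node_le k (f y) \<and> \<gamma> \<in> fst k" if \<gamma>: "\<gamma> |\<in>| \<Gamma>" for \<gamma>
    proof -
      obtain N where N: "open N" "y \<in> N" "\<forall>z\<in>N. node_le (f y) (f z)"
        using frame.interior_mapD(2)[OF f, of y] by auto
      have "y \<in> closure ({y. holds h y \<gamma>} \<inter> S)" using S(2) y \<gamma> by blast
      then have "N \<inter> ({y. holds h y \<gamma>} \<inter> S) \<noteq> {}"
        using N(2) open_Int_closure_eq_empty[OF N(1)] by blast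
      then obtain z where "z \<in> N" "holds h z \<gamma>" "z \<in> S" by blast
      then show ?thesis using N(3) max IH[OF \<gamma>] fW by blast
    qed
    then show ?rhs using y fW by blast
  next
    assume ?rhs
    then obtain m where m: "m \<in> nodes" "node_le (f x) m"
      and k: "\<And>\<gamma>. \<gamma> |\<in>| \<Gamma> \<Longrightarrow> \<exists>k\<in>nodes. node_le m k \<and> node_le k m \<and> \<gamma> \<in> fst k" by blast
    show "holds h x (Tangle \<Gamma>)"
      unfolding holds_Tangle
    \<comment> \<open>All points with values below the cluster of \<open>m\<close> form a witness:
      by openness each is a limit of every fibre over that cluster, and these fibres lie in the set
      themselves.\<close>
    proof (intro exI[of _ "{y. node_le (f y) m}"] conjI ballI)
      fix y \<gamma> assume y: "y \<in> {y. node_le (f y) m}" and \<gamma>: "\<gamma> \<in> fset \<Gamma>"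
      obtain k where k: "k \<in> nodes" "node_le m k" "node_le k m" "\<gamma> \<in> fst k" using k[OF \<gamma>] by blast
      have "node_le (f y) k" using y node_le_trans[OF _ k(2)] by simp
      then have "y \<in> closure {z. f z = k}" using frame.interior_mapD(3)[OF f k(1)] by blast
      moreover have "{z. f z = k} \<subseteq> {z. holds h z \<gamma>} \<inter> {y. node_le (f y) m}"
        using IH[OF \<gamma>] k(3,4) by auto
      ultimately show "y \<in> closure ({z. holds h z \<gamma>} \<inter> {y. node_le (f y) m})"
        using closure_mono by blast
    qed (use m in simp)
  qed
  then show ?case using node_Tangle[OF fW Tangle.prems] by simp
qed

lemma refutation:
  assumes "\<phi>0 \<notin> x0"
  shows "\<exists>h (x :: 'a::{metric_space, perfect_space}). \<not> holds h x \<phi>0"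
proof -
  have x0_node: "low x0 \<in> nodes" using x0_P by (auto simp: nodes_def)
  then have "nodes \<noteq> {}" by blast
  then obtain f :: "'a \<Rightarrow> 'v node" where f: "frame.interior_map f" "range f = nodes"
    using frame.interior_map_onto[OF _ nodes_connected] by metis
  then obtain x where x: "f x = low x0" using x0_node by (metis rangeE)
  have "\<phi>0 \<notin> fst (f x)" using assms by (simp add: x low_def tp_def)
  then show ?thesis
    using holds_iff_node[OF f, of "\<lambda>p. {x. Atom p \<in> fst (f x)}"] subf_refl by blast
qed

end

section \<open>Completeness and soundness of the two systems\<close>

lemma (in tangle_logic) completeness:
  assumes "\<phi> \<in> L" "valid_in TYPE('a::{metric_space, perfect_space}) \<phi>"
  shows "prov \<phi>"
proof (rule ccontr)
  assume not: "\<not> prov \<phi>"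
  have "consistent {Neg \<phi>}"
    unfolding consistent_def
  proof (intro conjI allI impI notI)
    fix \<phi>s assume *: "set \<phi>s \<subseteq> {Neg \<phi>}" "prov (Neg (Conj \<phi>s))"
    have "prov \<phi>"
      by (rule prov_conseq[of "[Neg (Conj \<phi>s)]"]) (use * assms in auto)
    then show False using not by blast
  qed (use assms in simp)
  then obtain x0 where x0: "Neg \<phi> \<in> x0" "mcs x0" using lindenbaum by blast
  then have "\<phi> \<notin> x0" using mcs_Neg assms(1) by blast
  interpret filtration L x0 \<phi>
    by unfold_locales (use x0 assms in auto)
  show False
    using refutation[OF \<open>\<phi> \<notin> x0\<close>, where 'a = 'a] assms(2) by (auto simp: valid_in_def)
qed

lemma tangle_logic_lang_basic: "tangle_logic lang_basic"
  by unfold_locales (auto intro: lang_basic.intros elim: lang_basic.cases)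

lemma tangle_logic_lang_tangle: "tangle_logic lang_tangle"
  by unfold_locales (auto intro: lang_tangle.intros elim: lang_tangle.cases)

text \<open>Makes the system of \<open>tangle_logic\<close> over \<open>lang_basic\<close> coincide
  with \<open>S4UC\<close>, although its axioms formally include (Fix) and (Ind).\<close>

lemma tangle_axiom_not_basic: "tangle_axiom \<phi> \<Longrightarrow> \<phi> \<notin> lang_basic"
  by (induction rule: tangle_axiom.induct)
    (auto simp: tangle_logic.L_Neg[OF tangle_logic_lang_basic] tangle_logic.L_And[OF tangle_logic_lang_basic]
      elim: lang_basic.cases)

lemma hilbert_thm_mono:
  assumes "hilbert_thm L Ax \<phi>" "\<And>\<phi>. \<phi> \<in> L \<Longrightarrow> Ax \<phi> \<Longrightarrow> Ax' \<phi>"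
  shows "hilbert_thm L Ax' \<phi>"
  using assms(1) by (induction rule: hilbert_thm.induct) (auto intro: hilbert_thm.intros assms(2))

theorem theorem9p2:
  shows "(complete_over TYPE('a::{metric_space, perfect_space}) lang_basic (S4UC :: 'v fm \<Rightarrow> bool) \<and>
         (connected (UNIV :: 'a set) \<longrightarrow> sound_over TYPE('a) (S4UC :: 'v fm \<Rightarrow> bool))) \<and>
         (complete_over TYPE('a) lang_tangle (S4tUC :: 'v fm \<Rightarrow> bool) \<and>
         (connected (UNIV :: 'a set) \<longrightarrow> sound_over TYPE('a) (S4tUC :: 'v fm \<Rightarrow> bool)))"
proof (intro conjI impI)
  show "complete_over TYPE('a) lang_basic (S4UC :: 'v fm \<Rightarrow> bool)"
    unfolding complete_over_def
  proof (intro ballI impI)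
    fix \<phi> :: "'v fm" assume "\<phi> \<in> lang_basic" "valid_in TYPE('a) \<phi>"
    from tangle_logic.completeness[OF tangle_logic_lang_basic this] show "S4UC \<phi>"
      unfolding S4UC_def by (rule hilbert_thm_mono) (use tangle_axiom_not_basic in blast)
  qed
  show "complete_over TYPE('a) lang_tangle (S4tUC :: 'v fm \<Rightarrow> bool)"
    unfolding complete_over_def S4tUC_def
    using tangle_logic.completeness[OF tangle_logic_lang_tangle] by blast
next
  assume conn: "connected (UNIV :: 'a set)"
  show "sound_over TYPE('a) (S4UC :: 'v fm \<Rightarrow> bool)"
    unfolding sound_over_def S4UC_def valid_in_def
    using hilbert_thm_valid[where ?'a = 'a] valid_S4UC_axiom[OF _ conn] by blast
  show "sound_over TYPE('a) (S4tUC :: 'v fm \<Rightarrow> bool)"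
    unfolding sound_over_def S4tUC_def valid_in_def
    using hilbert_thm_valid[where ?'a = 'a] valid_S4UC_axiom[OF _ conn] valid_tangle_axiom by blast
qed

end
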